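(* Suppose there is $B<\infty$ with $\left|\log\frac{p_m(x\mid y')}{p_m(x\mid y)}\right|\le B$ for all $m$, all $y\neq y'$, and all $x\in\mathcal{X}_m$. Then there exist constants $a_0\in(0,1)$ and $D>0$, depending on the instance $(\pi,(p_m),(c_m))$ but not on $\alpha$, such that for every $\alpha\in(0,1)^L$ with $\alpha_{\min}:=\min_y\alpha_y<a_0$ and $\mathrm{OPT}(\alpha)<\infty$, \[ 1\le\frac{\overline{\mathrm{OPT}}(\alpha)}{\mathrm{OPT}(\alpha)}\le 1+D\,\frac{\log\log(1/\alpha_{\min})}{\log(1/\alpha_{\min})}. \] In particular the ratio tends to $1$ as $\alpha_{\min}\to 0$.
   Context: Setting: $L\ge 2$ and $K\ge1$ are integers, $\mathcal{Y}=\{1,\dots,L\}$, $\pi$ is a prior on $\mathcal{Y}$ with $\pi(y)>0$ for all $y$; for each model $m\in\{1,\dots,K\}$, $\mathcal{X}_m$ is a finite alphabet, $p_m(\cdot\mid y)$ is a probability mass function on $\mathcal{X}_m$ with $p_m(x\mid y)>0$ for all $x,y$, and $c_m>0$ is a cost. Pairwise identifiability: for all $y\neq y'$ there is $m$ with $p_m(\cdot\mid y)\neq p_m(\cdot\mid y')$. For $r\in\mathbb{Z}_{\ge 0}^K$, $C(r)=\sum_m c_mr_m$. The ground truth $Y\sim\pi$; conditional on $Y=y$, outputs $X_{m,t}$ ($1\le m\le K$, $1\le t\le r_m$) are mutually independent with $X_{m,t}\sim p_m(\cdot\mid y)$. The MAP estimator $\widehat Y_r$ is a maximizer over $y$ of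 $\pi(y)\prod_{m,t}p_m(X_{m,t}\mid y)$ (ties broken by a fixed deterministic rule), $P_e(y;r):=\Pr(\widehat Y_r\neq y\mid Y=y)$. Let $M_m^{(y,y')}(s):=\sum_{x\in\mathcal{X}_m}p_m(x\mid y)^{1-s}p_m(x\mid y')^{s}$ and $\overline{P}_e(y;r):=\sum_{y'\neq y}\min_{s\in[0,1]}(\pi(y')/\pi(y))^{s}\prod_{m=1}^K(M_m^{(y,y')}(s))^{r_m}$. Define $\mathrm{OPT}(\alpha)=\min\{C(r):r\in\mathbb{Z}_{\ge0}^K,\ P_e(y;r)\le\alpha_y\ \forall y\}$ and $\overline{\mathrm{OPT}}(\alpha)=\min\{C(r):r\in\mathbb{Z}_{\ge0}^K,\ \overline{P}_e(y;r)\le\alpha_y\ \forall y\}$, with $\min\emptyset=+\infty$.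
   Formalization: The "fixed deterministic rule" for breaking ties is taken to be a fixed priority order on the labels (e.g. smallest index), with constants uniform over all such orders; for arbitrary tie selections that depend on the data or choose inconsistently between tied sets the claim fails. *)

theory Defs
  imports "HOL-Probability.Probability"
begin

text \<open>
  Labels and models are the elements of the finite types \<open>'y\<close> and \<open>'m\<close>, so
  \<open>L = CARD('y)\<close> and \<open>K = CARD('m)\<close>. The alphabets \<open>X m\<close> are finite subsets of a common
  type \<open>'x\<close>, and \<open>p m y\<close> is the conditional law \<open>p_m(\<cdot> | y)\<close>. An allocation is
  a function \<open>r :: 'm \<Rightarrow> nat\<close>, and the outputs \<open>X_{m,t}\<close> are indexed by the pairs \<open>(m, t)\<close>
  with \<open>1 \<le> t \<le> r m\<close>.
\<close>

definition total_cost :: "('m::finite \<Rightarrow> real) \<Rightarrow> ('m \<Rightarrow> nat) \<Rightarrow> real" where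
  "total_cost c r = (\<Sum>m\<in>UNIV. c m * real (r m))"

definition sample_index :: "('m::finite \<Rightarrow> nat) \<Rightarrow> ('m \<times> nat) set" where
  "sample_index r = (SIGMA m:UNIV. {1..r m})"

definition joint_law ::
  "'y::finite pmf \<Rightarrow> ('m::finite \<Rightarrow> 'y \<Rightarrow> 'x pmf) \<Rightarrow> ('m \<Rightarrow> nat) \<Rightarrow> ('y \<times> ('m \<times> nat \<Rightarrow> 'x)) pmf"
where
  "joint_law prior p r =
     bind_pmf prior (\<lambda>y. map_pmf (Pair y)
       (Pi_pmf (sample_index r) undefined (\<lambda>(m, t). p m y)))"

definition map_score ::
  "'y::finite pmf \<Rightarrow> ('m::finite \<Rightarrow> 'y \<Rightarrow> 'x pmf) \<Rightarrow> ('m \<Rightarrow> nat) \<Rightarrow> ('m \<times> nat \<Rightarrow> 'x) \<Rightarrow> 'y \<Rightarrow> real"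
where
  "map_score prior p r xs y =
     pmf prior y * (\<Prod>(m, t)\<in>sample_index r. pmf (p m y) (xs (m, t)))"

text \<open>
  The tie-breaking rule is a fixed priority order on the labels, given by an injective
  \<open>prio\<close>: among the maximizers the one with least \<open>prio\<close> is chosen.
\<close>

definition map_estimate ::
  "'y::finite pmf \<Rightarrow> ('m::finite \<Rightarrow> 'y \<Rightarrow> 'x pmf) \<Rightarrow> ('y \<Rightarrow> nat) \<Rightarrow> ('m \<Rightarrow> nat)
     \<Rightarrow> ('m \<times> nat \<Rightarrow> 'x) \<Rightarrow> 'y"
where
  "map_estimate prior p prio r xs =
     arg_min_on prio {y. \<forall>y'. map_score prior p r xs y' \<le> map_score prior p r xs y}"

definition error_prob ::
  "'y::finite pmf \<Rightarrow> ('m::finite \<Rightarrow> 'y \<Rightarrow> 'x pmf) \<Rightarrow> ('y \<Rightarrow> nat) \<Rightarrow> 'y \<Rightarrow> ('m \<Rightarrow> nat) \<Rightarrow> real"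
where
  "error_prob prior p prio y r =
     \<P>(\<omega> in measure_pmf (joint_law prior p r).
        map_estimate prior p prio r (snd \<omega>) \<noteq> y \<bar> fst \<omega> = y)"

definition tilted_sum ::
  "('m \<Rightarrow> 'x set) \<Rightarrow> ('m::finite \<Rightarrow> 'y::finite \<Rightarrow> 'x pmf) \<Rightarrow> 'm \<Rightarrow> 'y \<Rightarrow> 'y \<Rightarrow> real \<Rightarrow> real"
where
  "tilted_sum X p m y y' s = (\<Sum>x\<in>X m. pmf (p m y) x powr (1 - s) * pmf (p m y') x powr s)"

definition pair_bound ::
  "('m \<Rightarrow> 'x set) \<Rightarrow> 'y::finite pmf \<Rightarrow> ('m::finite \<Rightarrow> 'y \<Rightarrow> 'x pmf) \<Rightarrow> 'y \<Rightarrow> 'y \<Rightarrow> ('m \<Rightarrow> nat)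
     \<Rightarrow> real \<Rightarrow> real"
where
  "pair_bound X prior p y y' r s =
     (pmf prior y' / pmf prior y) powr s * (\<Prod>m\<in>UNIV. tilted_sum X p m y y' s ^ r m)"

text \<open>The infimum over \<open>s\<close> is a minimum, see \<open>pair_bound_attains_min\<close>.\<close>

definition error_bound ::
  "('m \<Rightarrow> 'x set) \<Rightarrow> 'y::finite pmf \<Rightarrow> ('m::finite \<Rightarrow> 'y \<Rightarrow> 'x pmf) \<Rightarrow> 'y \<Rightarrow> ('m \<Rightarrow> nat) \<Rightarrow> real"
where
  "error_bound X prior p y r =
     (\<Sum>y'\<in>UNIV - {y}. INF s\<in>{0..1}. pair_bound X prior p y y' r s)"

text \<open>
  The infimum is \<open>\<infinity>\<close> on the empty set; on a nonempty set it is a minimum,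
  see \<open>min_cost_attained\<close>.
\<close>

definition min_cost :: "('m::finite \<Rightarrow> real) \<Rightarrow> ('m \<Rightarrow> nat) set \<Rightarrow> ereal" where
  "min_cost c R = (INF r\<in>R. ereal (total_cost c r))"

definition OPT ::
  "'y::finite pmf \<Rightarrow> ('m::finite \<Rightarrow> 'y \<Rightarrow> 'x pmf) \<Rightarrow> ('m \<Rightarrow> real) \<Rightarrow> ('y \<Rightarrow> nat) \<Rightarrow> ('y \<Rightarrow> real) \<Rightarrow> ereal"
where
  "OPT prior p c prio \<alpha> = min_cost c {r. \<forall>y. error_prob prior p prio y r \<le> \<alpha> y}"

definition OPT_bar ::
  "('m \<Rightarrow> 'x set) \<Rightarrow> 'y::finite pmf \<Rightarrow> ('m::finite \<Rightarrow> 'y \<Rightarrow> 'x pmf) \<Rightarrow> ('m \<Rightarrow> real) \<Rightarrow> ('y \<Rightarrow> real)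
     \<Rightarrow> ereal"
where
  "OPT_bar X prior p c \<alpha> = min_cost c {r. \<forall>y. error_bound X prior p y r \<le> \<alpha> y}"

lemma pair_bound_attains_min:
  fixes X :: "'m::finite \<Rightarrow> 'x set" and prior :: "'y::finite pmf"
  assumes prior: "set_pmf prior = UNIV"
    and supp: "\<And>m y. set_pmf (p m y) = X m"
  shows "\<exists>s\<in>{0..1}. (INF s\<in>{0..1}. pair_bound X prior p y y' r s) = pair_bound X prior p y y' r s"
proof -
  have pos: "pmf (p m z) x \<noteq> 0" if "x \<in> X m" for m z x
    using that supp[of m z] by (simp add: set_pmf_iff[symmetric])
  have prior_pos: "pmf prior z \<noteq> 0" for z
    using prior by (simp add: set_pmf_iff[symmetric])
  have tilt: "continuous_on {0..1} (tilted_sum X p m y y')" for m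
    unfolding tilted_sum_def using pos[of _ m] by (intro continuous_intros) auto
  have "continuous_on {0..1} (pair_bound X prior p y y' r)"
    unfolding pair_bound_def using prior_pos[of y] prior_pos[of y']
    by (intro continuous_intros tilt) auto
  then obtain s where s: "s \<in> {0..1}"
      "\<forall>u\<in>{0..1}. pair_bound X prior p y y' r s \<le> pair_bound X prior p y y' r u"
    using continuous_attains_inf[of "{0..1::real}" "pair_bound X prior p y y' r"] by auto
  then have "(INF s\<in>{0..1}. pair_bound X prior p y y' r s) = pair_bound X prior p y y' r s"
    by (intro cInf_eq_minimum) auto
  with s(1) show ?thesis by blast
qed

lemma min_cost_attained:
  fixes c :: "'m::finite \<Rightarrow> real"
  assumes c: "\<And>m. 0 < c m" and "R \<noteq> {}"
  shows "\<exists>r\<in>R. min_cost c R = ereal (total_cost c r)"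
proof -
  obtain r0 where r0: "r0 \<in> R" using assms(2) by blast
  define S where "S = {r\<in>R. total_cost c r \<le> total_cost c r0}"
  define N where "N m = nat \<lfloor>total_cost c r0 / c m\<rfloor>" for m
  have "r m \<le> N m" if "r \<in> S" for r m
  proof -
    have "c m * real (r m) \<le> total_cost c r"
      unfolding total_cost_def using c by (intro member_le_sum) (auto simp: less_imp_le)
    also have "\<dots> \<le> total_cost c r0" using that by (simp add: S_def)
    finally have "real (r m) \<le> total_cost c r0 / c m"
      using c[of m] by (simp add: field_simps)
    then show ?thesis unfolding N_def by (simp add: le_nat_floor)
  qed
  then have "S \<subseteq> PiE UNIV (\<lambda>m. {..N m})" by auto
  then have fin: "finite S" by (rule finite_subset) (intro finite_PiE; simp)
  have "r0 \<in> S" using r0 by (simp add: S_def)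
  then obtain r where r: "r \<in> S" "\<forall>u\<in>S. total_cost c r \<le> total_cost c u"
    using ex_min_if_finite[of "total_cost c ` S"] fin by (force simp: not_less)
  have "total_cost c r \<le> total_cost c u" if "u \<in> R" for u
    using that r \<open>r0 \<in> S\<close> by (cases "u \<in> S") (force simp: S_def)+
  then have "min_cost c R = ereal (total_cost c r)"
    unfolding min_cost_def using r(1)
    by (intro antisym INF_greatest INF_lower2[of r]) (auto simp: S_def)
  with r(1) show ?thesis by (auto simp: S_def)
qed

end

theory Submission
  imports Defs "HOL-Real_Asymp.Real_Asymp"
begin

text \<open>
  The lower bound on the ratio is the Chernoff bound. For the upper bound let \<open>r\<close> be optimal for
  \<open>OPT\<close> and let \<open>n\<close> be its number of samples. If label \<open>y'\<close> wins for at least one output, then the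
  Chernoff bound of the pair \<open>(y, y')\<close>, at a parameter \<open>s\<close> in a fixed compact part of \<open>(0, 1)\<close>,
  exceeds the error probability of \<open>y\<close> by at most a factor polynomial in \<open>n\<close>. When few samples
  separate \<open>y\<close> from \<open>y'\<close>, already the outputs that agree with the winning one on these samples have
  probability bounded below. Otherwise some \<open>s\<close> gives the tilted log-likelihood ratio a
  prescribed positive mean, and the most likely type class of the tilted law, which has
  polynomially large probability and lies within bounded distance of the mean, consists of errors.
  Away from the endpoints of \<open>[0, 1]\<close> each extra sample of all models shrinks every Chernoff bound
  by a constant factor, so \<open>O(log n)\<close> extra rounds make \<open>r\<close> feasible for \<open>OPT_bar\<close>; finally
  \<open>n\<close> and the optimal cost are both of order \<open>log (1 / \<alpha>_min)\<close>.
\<close>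

section \<open>Sample positions, the MAP rule and conditioning on the true label\<close>

lemma finite_sample_index [simp]: "finite (sample_index r)"
  by (simp add: sample_index_def)

lemma prod_sample_index:
  "(\<Prod>i\<in>sample_index r. g (fst i)) = (\<Prod>m\<in>UNIV. g m ^ r m)"
  for g :: "'m::finite \<Rightarrow> real"
proof -
  have "(\<Prod>m\<in>UNIV. \<Prod>t\<in>{1..r m}. g m) = (\<Prod>(m, t)\<in>sample_index r. g m)"
    unfolding sample_index_def by (rule prod.Sigma) auto
  then show ?thesis by (simp add: case_prod_unfold)
qed

lemma sum_sample_index:
  "(\<Sum>i\<in>sample_index r. g i) = (\<Sum>m\<in>UNIV. \<Sum>t\<in>{1..r m}. g (m, t))"
  for g :: "('m::finite \<times> nat) \<Rightarrow> real"
  unfolding sample_index_def by (subst sum.Sigma) (auto simp: case_prod_unfold)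

text \<open>There are finitely many labels, so the set of maximizers is nonempty and
  \<open>arg_min_on\<close> returns one of its members with least \<open>prio\<close>. Later
  arguments use the estimator only through these two facts.\<close>

lemma map_estimate_properties:
  fixes prior :: "'y::finite pmf"
  shows map_estimate_maximal:
      "map_score prior p r xs y \<le> map_score prior p r xs (map_estimate prior p prio r xs)"
    and map_estimate_prio:
      "(\<And>z. map_score prior p r xs z \<le> map_score prior p r xs y)
        \<Longrightarrow> prio (map_estimate prior p prio r xs) \<le> prio y"
proof -
  define S where "S = {y. \<forall>y'. map_score prior p r xs y' \<le> map_score prior p r xs y}"
  obtain z where "map_score prior p r xs z = Max (range (map_score prior p r xs))"
    using Max_in[of "range (map_score prior p r xs)"] by fastforce
  then have "z \<in> S" by (auto simp: S_def)
  then have ne: "S \<noteq> {}" by auto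
  have est: "map_estimate prior p prio r xs = arg_min_on prio S"
    by (simp add: map_estimate_def S_def)
  show "map_score prior p r xs y \<le> map_score prior p r xs (map_estimate prior p prio r xs)"
    using arg_min_if_finite(1)[of S prio] ne unfolding est by (simp add: S_def)
  show "prio (map_estimate prior p prio r xs) \<le> prio y"
    if "\<And>z. map_score prior p r xs z \<le> map_score prior p r xs y"
    unfolding est by (rule arg_min_least) (use ne that in \<open>auto simp: S_def\<close>)
qed

text \<open>Mixing over the prior, only the term \<open>z = y\<close> survives. The error event and
  the sure event as \<open>Q\<close> give numerator and denominator of the conditional error
  probability.\<close>

lemma measure_joint_law:
  fixes prior :: "'y::finite pmf"
  shows "measure (measure_pmf (joint_law prior p r)) {\<omega>. Q (snd \<omega>) \<and> fst \<omega> = y}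
    = pmf prior y * measure (measure_pmf (Pi_pmf (sample_index r) undefined (\<lambda>(m, t). p m y))) {xs. Q xs}"
    (is "?lhs = pmf prior y * ?c")
proof -
  let ?P = "\<lambda>y. Pi_pmf (sample_index r) undefined (\<lambda>(m, t). p m y)"
  have "?lhs = measure_pmf.expectation prior
      (\<lambda>z. measure (measure_pmf (map_pmf (Pair z) (?P z))) {\<omega>. Q (snd \<omega>) \<and> fst \<omega> = y})"
    unfolding joint_law_def measure_pmf_bind
    by (subst measure_pmf.measure_bind[where N = "count_space UNIV"])
       (auto simp: space_subprob_algebra prob_space_imp_subprob_space measure_pmf.prob_space_axioms)
  also have "\<dots> = measure_pmf.expectation prior (\<lambda>z. if z = y then ?c else 0)"
    by (intro Bochner_Integration.integral_cong) (auto simp: vimage_def)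
  also have "\<dots> = pmf prior y * ?c"
    by (subst integral_measure_pmf_real[of UNIV])
       (auto simp: if_distrib[of "\<lambda>v. _ * v"] mult.commute cong: if_cong)
  finally show ?thesis .
qed

lemma error_prob_eq_measure:
  fixes prior :: "'y::finite pmf"
  assumes "pmf prior y \<noteq> 0"
  shows "error_prob prior p prio y r
    = measure (measure_pmf (Pi_pmf (sample_index r) undefined (\<lambda>(m, t). p m y)))
        {xs. map_estimate prior p prio r xs \<noteq> y}"
proof -
  let ?c = "measure (measure_pmf (Pi_pmf (sample_index r) undefined (\<lambda>(m, t). p m y)))
    {xs. map_estimate prior p prio r xs \<noteq> y}"
  have "error_prob prior p prio y r = (pmf prior y * ?c) / (pmf prior y * 1)"
    unfolding error_prob_def cond_prob_def
    by (rule arg_cong2[of _ _ _ _ "(/)"])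
       (use measure_joint_law[of prior p r "\<lambda>xs. map_estimate prior p prio r xs \<noteq> y" y]
          measure_joint_law[of prior p r "\<lambda>_. True" y] in \<open>simp_all only: space_measure_pmf UNIV_I simp_thms
          Collect_const if_True measure_pmf_UNIV\<close>)
  then show ?thesis using assms by simp
qed

section \<open>Elementary real inequalities\<close>

lemma finite_uniform_positive:
  fixes f :: "'a \<Rightarrow> real"
  assumes "finite S" "\<And>x. x \<in> S \<Longrightarrow> 0 < f x"
  obtains \<kappa> where "0 < \<kappa>" "\<kappa> < 1" "\<And>x. x \<in> S \<Longrightarrow> \<kappa> \<le> f x"
proof
  \<comment> \<open>The entry \<open>1/2\<close> covers the case of empty \<open>S\<close> and keeps
    the minimum below 1.\<close>
  let ?k = "Min (insert (1/2) (f ` S))"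
  show "0 < ?k" "?k < 1" "\<And>x. x \<in> S \<Longrightarrow> ?k \<le> f x"
    using assms by (auto simp: Min_less_iff intro!: Min_le)
qed

lemma ln_less_minus_one: "0 < x \<Longrightarrow> x \<noteq> 1 \<Longrightarrow> ln x < x - 1" for x :: real
  using ln_le_minus_one[of x] ln_eq_minus_one[of x] by fastforce

lemma exp_greater_add_one: "x \<noteq> 0 \<Longrightarrow> 1 + x < exp x" for x :: real
  using ln_less_minus_one[of "exp x"] by simp

text \<open>Strict convexity of the exponential: its tangent at \<open>s * u\<close> lies strictly
  below the graph at 0 and at \<open>u\<close>, and the two inequalities are averaged with weights
  \<open>1 - s\<close> and \<open>s\<close>.\<close>

lemma exp_scale_less:
  fixes s u :: real
  assumes "0 < s" "s < 1" "u \<noteq> 0"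
  shows "exp (s * u) < 1 - s + s * exp u"
proof -
  have 1: "exp (s * u) * (1 - s * u) < 1"
    using exp_greater_add_one[of "- (s * u)"] assms by (simp add: exp_minus field_simps)
  have 2: "exp (s * u) * (1 + (1 - s) * u) < exp u"
  proof -
    have "exp (s * u) * (1 + (1 - s) * u) < exp (s * u) * exp ((1 - s) * u)"
      using exp_greater_add_one[of "(1 - s) * u"] assms by simp
    also have "\<dots> = exp u" by (simp add: exp_add[symmetric] algebra_simps)
    finally show ?thesis .
  qed
  have "exp (s * u) = (1 - s) * (exp (s * u) * (1 - s * u)) + s * (exp (s * u) * (1 + (1 - s) * u))"
    by (simp add: algebra_simps)
  also have "\<dots> < (1 - s) * 1 + s * exp u"
    using 1 2 assms by (intro add_strict_mono mult_strict_left_mono) auto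
  finally show ?thesis by simp
qed

locale classification =
  fixes prior :: "'y::finite pmf"
    and X :: "'m::finite \<Rightarrow> 'x set"
    and p :: "'m \<Rightarrow> 'y \<Rightarrow> 'x pmf"
  assumes prior_pos: "set_pmf prior = UNIV"
    and alphabet: "finite (X m)"
    and full_support: "set_pmf (p m y) = X m"
    and identifiable: "y \<noteq> y' \<Longrightarrow> \<exists>m. p m y \<noteq> p m y'"
begin

subsection \<open>Outputs and error probabilities\<close>

text \<open>The support of the product law: extensional functions, because \<open>Pi_pmf\<close> is
  used with default value \<open>undefined\<close>.\<close>

definition outputs :: "('m \<Rightarrow> nat) \<Rightarrow> ('m \<times> nat \<Rightarrow> 'x) set" where
  "outputs r = PiE (sample_index r) (\<lambda>i. X (fst i))"

definition likelihood :: "('m \<Rightarrow> nat) \<Rightarrow> 'y \<Rightarrow> ('m \<times> nat \<Rightarrow> 'x) \<Rightarrow> real" where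
  "likelihood r y xs = (\<Prod>i\<in>sample_index r. pmf (p (fst i) y) (xs i))"

text \<open>Positive values favour the second label \<open>y'\<close>.\<close>

definition llr :: "'y \<Rightarrow> 'y \<Rightarrow> 'm \<Rightarrow> 'x \<Rightarrow> real" where
  "llr y y' m x = ln (pmf (p m y') x / pmf (p m y) x)"

definition informative :: "'y \<Rightarrow> 'y \<Rightarrow> 'm set" where
  "informative y y' = {m. p m y \<noteq> p m y'}"

lemma prior_gt_0 [simp]: "0 < pmf prior y"
  using prior_pos by (simp add: pmf_positive)

lemma prior_neq_0 [simp]: "pmf prior y \<noteq> 0"
  using prior_gt_0[of y] by linarith

lemma pmf_gt_0: "x \<in> X m \<Longrightarrow> 0 < pmf (p m y) x"
  using full_support by (simp add: pmf_positive)

lemma sum_pmf [simp]: "(\<Sum>x\<in>X m. pmf (p m y) x) = 1"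
  using alphabet full_support by (intro sum_pmf_eq_1) auto

lemma finite_outputs [simp]: "finite (outputs r)"
  unfolding outputs_def using alphabet by (intro finite_PiE) auto

lemma outputs_mem: "xs \<in> outputs r \<Longrightarrow> i \<in> sample_index r \<Longrightarrow> xs i \<in> X (fst i)"
  by (auto simp: outputs_def)

lemma map_score_eq: "map_score prior p r xs y = pmf prior y * likelihood r y xs"
  by (simp add: map_score_def likelihood_def case_prod_unfold)

lemma likelihood_gt_0: "xs \<in> outputs r \<Longrightarrow> 0 < likelihood r y xs"
  unfolding likelihood_def by (intro prod_pos) (auto intro!: pmf_gt_0 dest: outputs_mem)

lemma map_score_gt_0: "xs \<in> outputs r \<Longrightarrow> 0 < map_score prior p r xs y"
  by (simp add: map_score_eq likelihood_gt_0)

text \<open>Distributivity over the sample positions. The weight depends on a position only through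
  its model, so equal factors collect into powers.\<close>

lemma sum_prod_outputs:
  fixes u :: "'m \<Rightarrow> 'x \<Rightarrow> real"
  shows "(\<Sum>xs\<in>outputs r. \<Prod>i\<in>sample_index r. u (fst i) (xs i)) = (\<Prod>m\<in>UNIV. (\<Sum>x\<in>X m. u m x) ^ r m)"
  unfolding outputs_def using alphabet
  by (subst prod_sum_PiE[symmetric])
     (simp_all add: prod_sample_index[of "\<lambda>m. \<Sum>x\<in>X m. u m x"])

lemma error_prob_eq_sum:
  "error_prob prior p prio y r
    = (\<Sum>xs\<in>{xs\<in>outputs r. map_estimate prior p prio r xs \<noteq> y}. likelihood r y xs)"
proof -
  let ?P = "Pi_pmf (sample_index r) undefined (\<lambda>(m, t). p m y)"
  let ?E = "{xs. map_estimate prior p prio r xs \<noteq> y}"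
  have set: "set_pmf ?P = outputs r"
    by (subst set_Pi_pmf) (auto simp: outputs_def PiE_dflt_def full_support PiE_def Pi_def extensional_def)
  have "error_prob prior p prio y r = measure ?P ?E"
    by (rule error_prob_eq_measure[OF prior_neq_0])
  also have "\<dots> = measure ?P (?E \<inter> outputs r)"
    using measure_Int_set_pmf[of ?P ?E] by (simp add: set)
  also have "\<dots> = sum (pmf ?P) (?E \<inter> outputs r)"
    by (intro measure_measure_pmf_finite) simp
  also have "\<dots> = (\<Sum>xs\<in>{xs\<in>outputs r. map_estimate prior p prio r xs \<noteq> y}. likelihood r y xs)"
  proof (rule sum.cong)
    fix xs assume "xs \<in> {xs\<in>outputs r. map_estimate prior p prio r xs \<noteq> y}"
    then have "xs \<in> extensional (sample_index r)" by (simp add: outputs_def PiE_def)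
    then show "pmf ?P xs = likelihood r y xs"
      unfolding likelihood_def by (subst pmf_Pi') (auto simp: case_prod_unfold extensional_def)
  qed auto
  finally show ?thesis .
qed

lemma sum_likelihood_le_error_prob:
  assumes "T \<subseteq> outputs r" and "\<And>xs. xs \<in> T \<Longrightarrow> map_estimate prior p prio r xs \<noteq> y"
  shows "(\<Sum>xs\<in>T. likelihood r y xs) \<le> error_prob prior p prio y r"
  unfolding error_prob_eq_sum using assms
  by (intro sum_mono2) (auto dest: likelihood_gt_0[of _ _ y])

lemma sum_likelihood_eq_1: "(\<Sum>xs\<in>outputs r. likelihood r y xs) = 1"
  unfolding likelihood_def using sum_prod_outputs[of "\<lambda>m. pmf (p m y)" r] by simp

text \<open>A label that never wins is an error on every output, and the outputs have total mass 1.
  Feasibility with tolerances below 1 thus supplies a winning output for every label.\<close>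

lemma error_prob_less_1_wins:
  assumes "error_prob prior p prio y r < 1"
  shows "\<exists>xs\<in>outputs r. map_estimate prior p prio r xs = y"
proof (rule ccontr)
  assume "\<not> ?thesis"
  then have "1 \<le> error_prob prior p prio y r"
    using sum_likelihood_le_error_prob[of "outputs r" r prio y] by (auto simp: sum_likelihood_eq_1)
  with assms show False by simp
qed

section \<open>The Chernoff bound on the error probability\<close>

lemma tilted_term_eq:
  assumes "x \<in> X m"
  shows "pmf (p m y) x powr (1 - s) * pmf (p m y') x powr s
    = pmf (p m y) x * exp (s * llr y y' m x)"
proof -
  have pos: "0 < pmf (p m y) x" "0 < pmf (p m y') x" using pmf_gt_0[OF assms] by auto
  have "pmf (p m y) x powr (1 - s) * pmf (p m y') x powr s
      = exp (ln (pmf (p m y) x) + s * llr y y' m x)"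
    using pos by (simp add: powr_def llr_def ln_div algebra_simps flip: exp_add)
  also have "\<dots> = pmf (p m y) x * exp (s * llr y y' m x)"
    using pos by (simp add: exp_add)
  finally show ?thesis .
qed

text \<open>The tilted sum is the moment generating function of \<open>llr\<close> under
  \<open>y\<close>.\<close>

lemma tilted_sum_eq: "tilted_sum X p m y y' s = (\<Sum>x\<in>X m. pmf (p m y) x * exp (s * llr y y' m x))"
  unfolding tilted_sum_def by (intro sum.cong refl tilted_term_eq)

lemma X_nonempty: "X m \<noteq> {}"
  using sum_pmf[of m undefined] by force

lemma tilted_sum_gt_0: "0 < tilted_sum X p m y y' s"
  unfolding tilted_sum_eq using alphabet X_nonempty
  by (intro sum_pos mult_pos_pos pmf_gt_0) simp_all

lemma tilted_sum_nonneg [simp]: "0 \<le> tilted_sum X p m y y' s"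
  using tilted_sum_gt_0[of m y y' s] by linarith

lemma pair_bound_nonneg: "0 \<le> pair_bound X prior p y y' r s"
  unfolding pair_bound_def by (intro mult_nonneg_nonneg prod_nonneg) auto

lemma map_score_ratio:
  assumes "xs \<in> outputs r"
  shows "map_score prior p r xs y' / map_score prior p r xs y
    = pmf prior y' / pmf prior y * exp (\<Sum>i\<in>sample_index r. llr y y' (fst i) (xs i))"
proof -
  have "likelihood r y' xs / likelihood r y xs
      = (\<Prod>i\<in>sample_index r. exp (llr y y' (fst i) (xs i)))"
    unfolding likelihood_def prod_dividef[symmetric] llr_def
    using pmf_gt_0[OF outputs_mem[OF assms]] by (intro prod.cong) auto
  then show ?thesis
    by (simp add: map_score_eq exp_sum times_divide_times_eq[symmetric] del: times_divide_times_eq)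
qed

text \<open>Split the errors by the winning label \<open>y'\<close>. On each piece the score ratio
  of \<open>y'\<close> to \<open>y\<close> is at least 1, so inserting its power \<open>s\<close>
  only increases the sum; extended to all outputs, the sum factorizes.\<close>

lemma error_prob_le_error_bound:
  "error_prob prior p prio y r \<le> error_bound X prior p y r"
proof -
  let ?e = "\<lambda>xs. map_estimate prior p prio r xs"
  let ?sc = "map_score prior p r"
  have pair: "(\<Sum>xs\<in>{xs\<in>outputs r. ?e xs = y'}. likelihood r y xs) \<le> pair_bound X prior p y y' r s"
    if s: "s \<in> {0..1}" for y' s
  proof -
    have "(\<Sum>xs\<in>{xs\<in>outputs r. ?e xs = y'}. likelihood r y xs)
        \<le> (\<Sum>xs\<in>{xs\<in>outputs r. ?e xs = y'}. likelihood r y xs * (?sc xs y' / ?sc xs y) powr s)"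
    proof (rule sum_mono)
      fix xs assume xs: "xs \<in> {xs\<in>outputs r. ?e xs = y'}"
      then have "?sc xs y \<le> ?sc xs y'" using map_estimate_maximal by fastforce
      then have "1 \<le> (?sc xs y' / ?sc xs y) powr s"
        using s map_score_gt_0[of xs r y] xs by (intro ge_one_powr_ge_zero) auto
      then show "likelihood r y xs \<le> likelihood r y xs * (?sc xs y' / ?sc xs y) powr s"
        using likelihood_gt_0[of xs r y] xs by simp
    qed
    also have "\<dots> \<le> (\<Sum>xs\<in>outputs r. likelihood r y xs * (?sc xs y' / ?sc xs y) powr s)"
      using likelihood_gt_0 by (intro sum_mono2) (auto intro!: mult_nonneg_nonneg intro: less_imp_le)
    also have "\<dots> = (\<Sum>xs\<in>outputs r. (pmf prior y' / pmf prior y) powr s *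
        (\<Prod>i\<in>sample_index r. pmf (p (fst i) y) (xs i) * exp (s * llr y y' (fst i) (xs i))))"
    proof (intro sum.cong refl)
      fix xs assume xs: "xs \<in> outputs r"
      have "(?sc xs y' / ?sc xs y) powr s = (pmf prior y' / pmf prior y) powr s *
          exp (s * (\<Sum>i\<in>sample_index r. llr y y' (fst i) (xs i)))"
        unfolding map_score_ratio[OF xs] by (subst powr_mult) (simp_all add: powr_def)
      then show "likelihood r y xs * (?sc xs y' / ?sc xs y) powr s = (pmf prior y' / pmf prior y) powr s *
        (\<Prod>i\<in>sample_index r. pmf (p (fst i) y) (xs i) * exp (s * llr y y' (fst i) (xs i)))"
        by (simp add: likelihood_def prod.distrib exp_sum sum_distrib_left)
    qed
    also have "\<dots> = pair_bound X prior p y y' r s"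
      unfolding sum_distrib_left[symmetric] pair_bound_def tilted_sum_eq
      by (subst sum_prod_outputs[of "\<lambda>m x. pmf (p m y) x * exp (s * llr y y' m x)"]) simp
    finally show ?thesis .
  qed
  have "error_prob prior p prio y r
      = (\<Sum>y'\<in>UNIV - {y}. \<Sum>xs\<in>{xs\<in>outputs r. ?e xs = y'}. likelihood r y xs)"
    unfolding error_prob_eq_sum
    by (subst sum.group[symmetric, where T = "UNIV - {y}" and g = ?e])
       (auto intro!: sum.cong)
  also have "\<dots> \<le> error_bound X prior p y r"
    unfolding error_bound_def by (intro sum_mono cINF_greatest pair) auto
  finally show ?thesis .
qed

lemma informative_llr:
  assumes "m \<notin> informative y y'" "x \<in> X m"
  shows "llr y y' m x = 0"
  using assms pmf_gt_0[of x m y] by (simp add: llr_def informative_def)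

text \<open>
  A label \<open>y'\<close> that wins for some output keeps its advantage over \<open>y\<close>, ties included, when only the
  outputs of models that do not separate \<open>y\<close> from \<open>y'\<close> are changed.
\<close>
lemma error_prob_ge_power:
  assumes prio: "inj prio" and yy': "y \<noteq> y'"
    and xs0: "xs0 \<in> outputs r" "map_estimate prior p prio r xs0 = y'"
    and \<epsilon>: "0 < \<epsilon>" "\<And>m x. x \<in> X m \<Longrightarrow> \<epsilon> \<le> pmf (p m y) x"
  shows "\<epsilon> ^ (\<Sum>m\<in>informative y y'. r m) \<le> error_prob prior p prio y r"
proof -
  let ?sc = "map_score prior p r"
  let ?I = "informative y y'"
  \<comment> \<open>The winning output is frozen at the samples of informative models and free at
    all others.\<close>
  define E where "E = PiE (sample_index r) (\<lambda>i. if fst i \<in> ?I then {xs0 i} else X (fst i))"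
  have sub: "E \<subseteq> outputs r"
    unfolding E_def outputs_def using outputs_mem[OF xs0(1)] by (intro PiE_mono) auto
  have ne: "map_estimate prior p prio r xs \<noteq> y" if xs: "xs \<in> E" for xs
  proof
    assume est: "map_estimate prior p prio r xs = y"
    have out: "xs \<in> outputs r" using sub xs by blast
    have "(\<Sum>i\<in>sample_index r. llr y y' (fst i) (xs i))
        = (\<Sum>i\<in>sample_index r. llr y y' (fst i) (xs0 i))"
    proof (intro sum.cong refl)
      fix i assume i: "i \<in> sample_index r"
      show "llr y y' (fst i) (xs i) = llr y y' (fst i) (xs0 i)"
        using xs i outputs_mem[OF out i] outputs_mem[OF xs0(1) i]
        by (cases "fst i \<in> ?I") (auto simp: E_def informative_llr dest: PiE_mem)
    qed
    then have ratio: "?sc xs y' / ?sc xs y = ?sc xs0 y' / ?sc xs0 y"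
      by (simp add: map_score_ratio out xs0)
    have le: "?sc xs y' \<le> ?sc xs y" using map_estimate_maximal[of prior p r xs y' prio] est by simp
    have le0: "?sc xs0 z \<le> ?sc xs0 y'" for z
      using map_estimate_maximal[of prior p r xs0 z prio] xs0 by simp
    have pos: "0 < ?sc xs y" "0 < ?sc xs0 y" using map_score_gt_0 out xs0(1) by auto
    \<comment> \<open>The two ratios are equal and lie on opposite sides of 1, so \<open>y\<close>
      and \<open>y'\<close> tie in both outputs. The priority rule then gives
      \<open>prio y \<le> prio y'\<close> from \<open>xs\<close> and the reverse from
      \<open>xs0\<close>, against injectivity.\<close>
    have "?sc xs y' / ?sc xs y \<le> 1" "1 \<le> ?sc xs0 y' / ?sc xs0 y"
      using le le0[of y] pos by simp_all
    then have "?sc xs y' / ?sc xs y = 1" "?sc xs0 y' / ?sc xs0 y = 1" using ratio by linarith+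
    then have eq: "?sc xs y' = ?sc xs y" "?sc xs0 y' = ?sc xs0 y" using pos by simp_all
    have "prio y \<le> prio y'"
      using map_estimate_prio[of prior p r xs y' prio] map_estimate_maximal[of prior p r xs _ prio] est eq(1)
      by simp
    moreover have "prio y' \<le> prio y"
      using map_estimate_prio[of prior p r xs0 y prio] le0 xs0(2) eq(2) by simp
    ultimately show False using prio yy' by (auto dest: injD)
  qed
  \<comment> \<open>The mass of \<open>E\<close> factorizes: a frozen position contributes at least
    \<epsilon>, a free one exactly 1.\<close>
  have "\<epsilon> ^ (\<Sum>m\<in>?I. r m) = (\<Prod>m\<in>UNIV. (if m \<in> ?I then \<epsilon> else 1) ^ r m)"
    by (simp add: power_sum prod.If_cases if_distrib[of "\<lambda>x. x ^ _"] cong: if_cong)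
  also have "\<dots> = (\<Prod>i\<in>sample_index r. if fst i \<in> ?I then \<epsilon> else 1)"
    by (rule prod_sample_index[of "\<lambda>m. if m \<in> ?I then \<epsilon> else 1", symmetric])
  also have "\<dots> \<le> (\<Prod>i\<in>sample_index r. \<Sum>x\<in>(if fst i \<in> ?I then {xs0 i} else X (fst i)). pmf (p (fst i) y) x)"
    using \<epsilon> outputs_mem[OF xs0(1)] by (intro prod_mono) auto
  also have "\<dots> = (\<Sum>xs\<in>E. likelihood r y xs)"
    unfolding E_def likelihood_def using alphabet by (intro prod_sum_PiE) auto
  also have "\<dots> \<le> error_prob prior p prio y r"
    by (rule sum_likelihood_le_error_prob[OF sub ne])
  finally show ?thesis .
qed

subsection \<open>Type classes\<close>

text \<open>Counts instead of frequencies; the restriction to \<open>Sigma UNIV X\<close> places all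
  types in a finite function space.\<close>

definition type_of :: "('m \<Rightarrow> nat) \<Rightarrow> ('m \<times> nat \<Rightarrow> 'x) \<Rightarrow> 'm \<times> 'x \<Rightarrow> nat" where
  "type_of r xs = (\<lambda>j\<in>Sigma UNIV X. card {t\<in>{1..r (fst j)}. xs (fst j, t) = snd j})"

lemma type_of_apply:
  "x \<in> X m \<Longrightarrow> type_of r xs (m, x) = card {t\<in>{1..r m}. xs (m, t) = x}"
  by (simp add: type_of_def)

text \<open>Group the positions of model \<open>m\<close> by symbol. Additive statistics such as the
  log-likelihood ratio therefore depend on the type alone.\<close>

lemma sum_type_of:
  fixes g :: "'x \<Rightarrow> real"
  assumes "xs \<in> outputs r"
  shows "(\<Sum>x\<in>X m. real (type_of r xs (m, x)) * g x) = (\<Sum>t\<in>{1..r m}. g (xs (m, t)))"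
proof -
  have "(\<Sum>t\<in>{1..r m}. g (xs (m, t)))
      = (\<Sum>x\<in>X m. \<Sum>t\<in>{t\<in>{1..r m}. xs (m, t) = x}. g (xs (m, t)))"
    using outputs_mem[OF assms] alphabet
    by (intro sum.group[symmetric]) (force simp: sample_index_def)+
  then show ?thesis by (simp add: type_of_apply)
qed

lemma type_of_update:
  assumes xs: "xs \<in> outputs r" and t: "t \<in> {1..r m}" and xz: "x \<in> X m" "x \<noteq> z" "xs (m, t) = z"
  shows "type_of r (xs((m, t) := x))
    = (type_of r xs)((m, z) := type_of r xs (m, z) - 1, (m, x) := type_of r xs (m, x) + 1)"
proof
  fix j :: "'m \<times> 'x"
  obtain l w where j: "j = (l, w)" by (cases j)
  have z: "z \<in> X m" using outputs_mem[OF xs, of "(m, t)"] t xz by (auto simp: sample_index_def)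
  have at_z: "{u\<in>{1..r m}. (xs((m, t) := x)) (m, u) = z} = {u\<in>{1..r m}. xs (m, u) = z} - {t}"
    using t xz by auto
  have at_x: "{u\<in>{1..r m}. (xs((m, t) := x)) (m, u) = x} = insert t {u\<in>{1..r m}. xs (m, u) = x}"
    using t xz by auto
  have elsewhere: "{u\<in>{1..r l}. (xs((m, t) := x)) (l, u) = w} = {u\<in>{1..r l}. xs (l, u) = w}"
    if "(l, w) \<noteq> (m, z)" "(l, w) \<noteq> (m, x)"
    using t xz that by auto
  show "type_of r (xs((m, t) := x)) j
    = ((type_of r xs)((m, z) := type_of r xs (m, z) - 1, (m, x) := type_of r xs (m, x) + 1)) j"
  proof (cases "w \<in> X l")
    case False
    then show ?thesis using z xz by (auto simp: j type_of_def)
  next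
    case True
    consider "(l, w) = (m, z)" | "(l, w) = (m, x)" | "(l, w) \<noteq> (m, z)" "(l, w) \<noteq> (m, x)" by blast
    then show ?thesis
    proof cases
      case 1
      then show ?thesis using z xz t at_z by (auto simp: j type_of_apply)
    next
      case 2
      then show ?thesis using xz t at_x by (auto simp: j type_of_apply)
    next
      case 3
      then show ?thesis using True elsewhere
        by (auto simp: j type_of_apply)
    qed
  qed
qed

text \<open>
  Replacing one occurrence of \<open>z\<close> by \<open>x\<close> in the outputs of model \<open>m\<close> maps one type class to a
  neighbouring one; count the pairs of a sequence and a replaceable position.
\<close>
lemma type_class_swap:
  fixes q :: "'m \<Rightarrow> 'x \<Rightarrow> real" and r :: "'m \<Rightarrow> nat"
  assumes xz: "x \<in> X m" "z \<in> X m" "x \<noteq> z" and q: "\<And>m x. 0 \<le> q m x"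
  defines "W \<equiv> \<lambda>k. \<Sum>xs\<in>{xs\<in>outputs r. type_of r xs = k}. \<Prod>i\<in>sample_index r. q (fst i) (xs i)"
  shows "W k * real (k (m, z)) * q m x
    \<le> W (k((m, z) := k (m, z) - 1, (m, x) := k (m, x) + 1)) * real (k (m, x) + 1) * q m z"
proof -
  \<comment> \<open>The subtraction is truncated, but if \<open>k (m, z) = 0\<close> the left-hand
    side of the claim is 0.\<close>
  define k' where "k' = k((m, z) := k (m, z) - 1, (m, x) := k (m, x) + 1)"
  let ?T = "\<lambda>k. {xs\<in>outputs r. type_of r xs = k}"
  let ?v = "\<lambda>xs. \<Prod>i\<in>sample_index r. q (fst i) (xs i)"
  \<comment> \<open>\<open>A k w\<close> marks one occurrence of \<open>w\<close> in a sequence of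
    type \<open>k\<close>; each such sequence is counted \<open>k (m, w)\<close> times.\<close>
  define A where "A k w = (SIGMA xs:?T k. {t\<in>{1..r m}. xs (m, t) = w})" for k w
  define \<phi> where "\<phi> = (\<lambda>(xs, t). (xs((m, t) := x), t::nat))"
  have fin: "finite (A k w)" for k w by (simp add: A_def)
  have sumA: "(\<Sum>a\<in>A k w. ?v (fst a)) = W k * real (k (m, w))" if "w \<in> X m" for k w
  proof -
    have "(\<Sum>a\<in>A k w. ?v (fst a)) = (\<Sum>xs\<in>?T k. \<Sum>t\<in>{t\<in>{1..r m}. xs (m, t) = w}. ?v xs)"
      unfolding A_def by (subst sum.Sigma) (auto simp: case_prod_unfold)
    also have "\<dots> = (\<Sum>xs\<in>?T k. ?v xs * real (k (m, w)))"
      using that by (intro sum.cong) (auto simp: type_of_apply)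
    finally show ?thesis by (simp add: W_def sum_distrib_right)
  qed
  have swap: "?v xs * q m x = ?v (xs((m, t) := x)) * q m z"
    if "t \<in> {1..r m}" "xs (m, t) = z" for xs t
  proof -
    have mt: "(m, t) \<in> sample_index r" using that by (simp add: sample_index_def)
    have "(\<Prod>i\<in>sample_index r - {(m, t)}. q (fst i) (xs i))
        = (\<Prod>i\<in>sample_index r - {(m, t)}. q (fst i) ((xs((m, t) := x)) i))"
      by (intro prod.cong) auto
    then show ?thesis
      using that(2) by (simp add: prod.remove[OF finite_sample_index mt] mult_ac)
  qed
  \<comment> \<open>The position is kept and the overwritten symbol is known to be \<open>z\<close>,
    so the replacement can be undone.\<close>
  have inj: "inj_on \<phi> (A k z)"
  proof (rule inj_onI)
    fix a b assume ab: "a \<in> A k z" "b \<in> A k z" "\<phi> a = \<phi> b"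
    obtain xs t ys u where [simp]: "a = (xs, t)" "b = (ys, u)" by (cases a, cases b)
    have [simp]: "u = t" using ab(3) by (simp add: \<phi>_def)
    have upd: "(xs((m, t) := x)) i = (ys((m, t) := x)) i" for i using ab(3) by (simp add: \<phi>_def)
    have "xs i = ys i" for i
      using ab(1,2) upd[of i] by (cases "i = (m, t)") (auto simp: A_def)
    then show "a = b" by auto
  qed
  have img: "\<phi> ` A k z \<subseteq> A k' x"
  proof (rule image_subsetI)
    fix b assume "b \<in> A k z"
    moreover obtain xs t where b: "b = (xs, t)" by (cases b)
    ultimately have xs: "xs \<in> outputs r" "type_of r xs = k" and t: "t \<in> {1..r m}" "xs (m, t) = z"
      by (auto simp: A_def)
    have "xs((m, t) := x) \<in> outputs r"
      using xs(1) t xz(1) by (simp add: outputs_def sample_index_def PiE_iff extensional_def)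
    moreover have "type_of r (xs((m, t) := x)) = k'"
      using type_of_update[OF xs(1) t(1) xz(1) xz(3) t(2)] xs(2) by (simp add: k'_def)
    ultimately show "\<phi> b \<in> A k' x" using t by (auto simp: b \<phi>_def A_def)
  qed
  have "W k * real (k (m, z)) * q m x = (\<Sum>a\<in>A k z. ?v (fst a) * q m x)"
    by (simp add: sumA xz sum_distrib_right[symmetric])
  also have "\<dots> = (\<Sum>a\<in>A k z. ?v (fst (\<phi> a)) * q m z)"
    by (intro sum.cong refl) (use swap in \<open>auto simp: A_def \<phi>_def\<close>)
  also have "\<dots> = (\<Sum>b\<in>\<phi> ` A k z. ?v (fst b) * q m z)"
    by (simp add: sum.reindex[OF inj])
  also have "\<dots> \<le> (\<Sum>b\<in>A k' x. ?v (fst b) * q m z)"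
    using q by (intro sum_mono2 img fin mult_nonneg_nonneg prod_nonneg) auto
  also have "\<dots> = W k' * real (k' (m, x)) * q m z"
    by (simp add: sumA xz sum_distrib_right[symmetric])
  finally show ?thesis by (simp add: k'_def)
qed

text \<open>No count exceeds the total number of samples, so there are only polynomially many types,
  with a degree fixed by the alphabets.\<close>

lemma card_types_le:
  "card (type_of r ` outputs r) \<le> (sum r UNIV + 1) ^ card (Sigma UNIV X)"
proof -
  have "type_of r ` outputs r \<subseteq> (PiE (Sigma UNIV X) (\<lambda>_. {..sum r UNIV}))"
  proof clarify
    fix xs :: "'m \<times> nat \<Rightarrow> 'x"
    have "card {t\<in>{1..r m}. xs (m, t) = x} \<le> sum r UNIV" for m x
    proof -
      have "card {t\<in>{1..r m}. xs (m, t) = x} \<le> card {1..r m}" by (intro card_mono) auto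
      also have "\<dots> \<le> sum r UNIV" using member_le_sum[of m UNIV r] by simp
      finally show ?thesis .
    qed
    then show "type_of r xs \<in> (PiE (Sigma UNIV X) (\<lambda>_. {..sum r UNIV}))"
      by (auto simp: type_of_def)
  qed
  then have "card (type_of r ` outputs r) \<le> card (PiE (Sigma UNIV X) (\<lambda>_. {..sum r UNIV}))"
    using alphabet by (intro card_mono finite_PiE) auto
  then show ?thesis using alphabet by (simp add: card_PiE)
qed

text \<open>\<open>T\<close> is a type class of greatest weight. It is polynomially large by the
  pigeonhole principle. Since no swap leads to a heavier class, \<open>k (m, z) * q m x\<close> is
  at most \<open>(k (m, x) + 1) * q m z\<close>, and summing over \<open>z\<close> gives the lower
  bound on the counts.\<close>

lemma modal_type_class:
  fixes q :: "'m \<Rightarrow> 'x \<Rightarrow> real"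
  assumes q: "\<And>m x. 0 \<le> q m x" "\<And>m. (\<Sum>x\<in>X m. q m x) = 1"
  obtains T where "T \<subseteq> outputs r"
    and "1 \<le> (real (sum r UNIV) + 1) ^ card (Sigma UNIV X) *
           (\<Sum>xs\<in>T. \<Prod>i\<in>sample_index r. q (fst i) (xs i))"
    and "\<And>xs m x. xs \<in> T \<Longrightarrow> x \<in> X m \<Longrightarrow> real (r m) * q m x - 1 \<le> real (type_of r xs (m, x))"
proof -
  let ?v = "\<lambda>xs. \<Prod>i\<in>sample_index r. q (fst i) (xs i)"
  let ?K = "type_of r ` outputs r"
  define W where "W k = (\<Sum>xs\<in>{xs\<in>outputs r. type_of r xs = k}. ?v xs)" for k
  have "outputs r \<noteq> {}"
    using sum_likelihood_eq_1[of r undefined] by force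
  then have "finite ?K" "?K \<noteq> {}" by auto
  then obtain k where k: "k \<in> ?K" "\<forall>j\<in>?K. W j \<le> W k"
    using Max_in[of "W ` ?K"] Max_ge[of "W ` ?K"] by fastforce
  have total: "1 = (\<Sum>j\<in>?K. W j)"
  proof -
    have "(\<Sum>j\<in>?K. W j) = (\<Sum>xs\<in>outputs r. ?v xs)"
      unfolding W_def by (rule sum.group) auto
    then show ?thesis using q by (simp add: sum_prod_outputs)
  qed
  also have "\<dots> \<le> real (card ?K) * W k" using k by (intro sum_bounded_above) auto
  finally have "1 \<le> real (card ?K) * W k" .
  moreover have W0: "0 \<le> W j" for j unfolding W_def using q by (intro sum_nonneg prod_nonneg) auto
  moreover have "real (card ?K) \<le> (real (sum r UNIV) + 1) ^ card (Sigma UNIV X)"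
    using of_nat_mono[OF card_types_le[of r], where ?'a = real] by (simp add: add_ac)
  ultimately have big: "1 \<le> (real (sum r UNIV) + 1) ^ card (Sigma UNIV X) * W k"
    by (meson mult_right_mono order_trans)
  then have Wk: "0 < W k" using W0[of k] by (cases "W k = 0") auto
  \<comment> \<open>A count function that no output has carries weight 0, so maximality also covers
    the neighbour \<open>?k'\<close> below, whether or not it is realized.\<close>
  have Wle: "W j \<le> W k" for j
  proof (cases "j \<in> ?K")
    case False
    then have "{xs\<in>outputs r. type_of r xs = j} = {}" by auto
    then have "W j = 0" unfolding W_def by (simp only: sum.empty)
    then show ?thesis using W0[of k] by simp
  qed (use k in auto)
  have bal: "real (k (m, z)) * q m x \<le> real (k (m, x) + 1) * q m z" if "x \<in> X m" "z \<in> X m" for m x z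
  proof (cases "x = z")
    case False
    let ?k' = "k((m, z) := k (m, z) - 1, (m, x) := k (m, x) + 1)"
    have "W k * real (k (m, z)) * q m x \<le> W ?k' * real (k (m, x) + 1) * q m z"
      unfolding W_def using type_class_swap[OF that False, of q r k] q(1) by blast
    also have "\<dots> \<le> W k * real (k (m, x) + 1) * q m z"
      using q(1) by (intro mult_right_mono Wle) auto
    finally show ?thesis using Wk by (simp add: mult.assoc)
  qed (use q(1) in \<open>auto intro!: mult_right_mono\<close>)
  have "real (r m) * q m x - 1 \<le> real (k (m, x))" if x: "x \<in> X m" for m x
  proof -
    obtain xs where xs: "xs \<in> outputs r" "type_of r xs = k" using k by blast
    have "real (r m) * q m x = (\<Sum>z\<in>X m. real (k (m, z)) * q m x)"
      using sum_type_of[OF xs(1), where g = "\<lambda>_. 1" and m = m] xs(2) by (simp add: sum_distrib_right[symmetric])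
    also have "\<dots> \<le> (\<Sum>z\<in>X m. real (k (m, x) + 1) * q m z)" by (intro sum_mono bal x)
    also have "\<dots> = real (k (m, x) + 1)" using q(2) by (simp add: sum_distrib_left[symmetric])
    finally show ?thesis by simp
  qed
  with big show thesis by (intro that[of "{xs\<in>outputs r. type_of r xs = k}"]) (auto simp: W_def)
qed

subsection \<open>Exponential tilting\<close>

text \<open>The exponential family that joins \<open>p m y\<close> at \<open>s = 0\<close> to
  \<open>p m y'\<close> at \<open>s = 1\<close>.\<close>

definition tilt :: "'y \<Rightarrow> 'y \<Rightarrow> real \<Rightarrow> 'm \<Rightarrow> 'x \<Rightarrow> real" where
  "tilt y y' s m x = pmf (p m y) x * exp (s * llr y y' m x) / tilted_sum X p m y y' s"

text \<open>This is the derivative in \<open>s\<close> of the logarithm of the tilted sum.\<close>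

definition tilted_mean :: "'y \<Rightarrow> 'y \<Rightarrow> real \<Rightarrow> 'm \<Rightarrow> real" where
  "tilted_mean y y' s m = (\<Sum>x\<in>X m. tilt y y' s m x * llr y y' m x)"

lemma tilt_nonneg: "0 \<le> tilt y y' s m x"
  using tilted_sum_gt_0[of m y y' s] by (simp add: tilt_def)

lemma sum_tilt: "(\<Sum>x\<in>X m. tilt y y' s m x) = 1"
  unfolding tilt_def sum_divide_distrib[symmetric] tilted_sum_eq[symmetric]
  using tilted_sum_gt_0[of m y y' s] by simp

text \<open>
  The parameter \<open>s\<close> is chosen so that the tilted mean of the log-likelihood ratio exceeds its possible
  fluctuation \<open>C\<close> over the modal type class by one; on that class \<open>y'\<close> then beats \<open>y\<close>, by a bounded factor.
\<close>
lemma pair_bound_le_error_prob: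
  assumes s: "0 \<le> s" "s \<le> 1"
    and B: "\<And>m x. x \<in> X m \<Longrightarrow> \<bar>llr y y' m x\<bar> \<le> B"
    and C: "C = 2 * B * real (card (Sigma UNIV X))"
    and mean: "ln (pmf prior y' / pmf prior y) + (\<Sum>m\<in>UNIV. real (r m) * tilted_mean y y' s m) = C + 1"
  shows "pair_bound X prior p y y' r s
    \<le> exp (2 * C + 1) * (real (sum r UNIV) + 1) ^ card (Sigma UNIV X) * error_prob prior p prio y r"
proof -
  let ?n = "(real (sum r UNIV) + 1) ^ card (Sigma UNIV X)"
  let ?v = "\<lambda>xs. \<Prod>i\<in>sample_index r. tilt y y' s (fst i) (xs i)"
  obtain T where T: "T \<subseteq> outputs r" "1 \<le> ?n * (\<Sum>xs\<in>T. ?v xs)"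
    and near: "\<And>xs m x. xs \<in> T \<Longrightarrow> x \<in> X m \<Longrightarrow> real (r m) * tilt y y' s m x - 1 \<le> real (type_of r xs (m, x))"
    by (rule modal_type_class[of "tilt y y' s" r, OF tilt_nonneg sum_tilt]) (rule that; simp)
  define L where "L xs = (\<Sum>i\<in>sample_index r. llr y y' (fst i) (xs i))" for xs
  define S where "S xs = ln (pmf prior y' / pmf prior y) + L xs" for xs
  have S: "1 \<le> S xs \<and> S xs \<le> 2 * C + 1" if xs: "xs \<in> T" for xs
  proof -
    have out: "xs \<in> outputs r" using xs T by blast
    define d where "d m x = real (type_of r xs (m, x)) - real (r m) * tilt y y' s m x" for m x
    \<comment> \<open>From \<open>d m x \<ge> -1\<close> follows
      \<open>\<bar>d m x\<bar> \<le> d m x + 2\<close>. As the deviations sum to 0, the one-sided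
      bound on the counts controls both signs.\<close>
    have d: "(\<Sum>x\<in>X m. \<bar>d m x\<bar>) \<le> 2 * real (card (X m))" for m
    proof -
      have "(\<Sum>x\<in>X m. \<bar>d m x\<bar>) \<le> (\<Sum>x\<in>X m. d m x + 2)"
        using near[OF xs] by (intro sum_mono) (force simp: d_def)
      also have "(\<Sum>x\<in>X m. d m x) = 0"
        using sum_type_of[OF out, where g = "\<lambda>_. 1" and m = m]
        by (simp add: d_def sum_subtractf sum_distrib_left[symmetric] sum_tilt)
      then have "(\<Sum>x\<in>X m. d m x + 2) = 2 * real (card (X m))" by (simp add: sum.distrib)
      finally show ?thesis .
    qed
    have "L xs = (\<Sum>m\<in>UNIV. \<Sum>x\<in>X m. real (type_of r xs (m, x)) * llr y y' m x)"
      by (simp add: L_def sum_sample_index sum_type_of[OF out])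
    \<comment> \<open>By the mean condition \<open>C + 1\<close> is the value of \<open>S\<close> at
      the exact tilted frequencies, so only the deviations remain, and they contribute at most
      \<open>C\<close>.\<close>
    then have "S xs - (C + 1) = (\<Sum>m\<in>UNIV. \<Sum>x\<in>X m. d m x * llr y y' m x)"
      unfolding mean[symmetric]
      by (simp add: S_def d_def tilted_mean_def sum_subtractf[symmetric] sum_distrib_left algebra_simps)
    also have "\<bar>\<dots>\<bar> \<le> (\<Sum>m\<in>UNIV. \<Sum>x\<in>X m. \<bar>d m x\<bar> * B)"
      using B by (intro order_trans[OF sum_abs] sum_mono order_trans[OF sum_abs])
        (auto simp: abs_mult intro!: mult_left_mono)
    also have "\<dots> \<le> (\<Sum>m\<in>UNIV. 2 * real (card (X m)) * B)"
    proof (intro sum_mono)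
      fix m
      obtain x where "x \<in> X m" using X_nonempty by blast
      then have "0 \<le> B" using B[of x m] by linarith
      then show "(\<Sum>x\<in>X m. \<bar>d m x\<bar> * B) \<le> 2 * real (card (X m)) * B"
        using d[of m] by (simp add: sum_distrib_right[symmetric] mult_right_mono)
    qed
    also have "\<dots> = C"
      using alphabet by (simp add: C sum_distrib_left sum_distrib_right[symmetric] mult_ac)
    finally show ?thesis by linarith
  qed
  have exp_S: "map_score prior p r xs y' / map_score prior p r xs y = exp (S xs)" if "xs \<in> outputs r" for xs
    using map_score_ratio[OF that, of y' y] by (simp add: S_def L_def exp_add)
  have ne: "map_estimate prior p prio r xs \<noteq> y" if xs: "xs \<in> T" for xs
  proof
    assume "map_estimate prior p prio r xs = y"
    then have "map_score prior p r xs y' \<le> map_score prior p r xs y"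
      using map_estimate_maximal[of prior p r xs y' prio] by simp
    moreover have "0 < map_score prior p r xs y" using map_score_gt_0 T xs by blast
    ultimately have "map_score prior p r xs y' / map_score prior p r xs y \<le> 1" by simp
    then have "exp (S xs) \<le> 1" using exp_S[of xs] T(1) xs by auto
    then show False using S[OF xs] by simp
  qed
  \<comment> \<open>Change of measure from the tilted law back to the law of \<open>y\<close>: the
    normalizer \<open>M\<close> cancels against the tilted sums in \<open>pair_bound\<close>, which
    leaves the bounded factor \<open>exp (s * S xs)\<close>.\<close>
  have lik: "pair_bound X prior p y y' r s * ?v xs \<le> exp (2 * C + 1) * likelihood r y xs" if xs: "xs \<in> T" for xs
  proof -
    define M where "M = (\<Prod>m\<in>UNIV. tilted_sum X p m y y' s ^ r m)"
    have M: "M = (\<Prod>i\<in>sample_index r. tilted_sum X p (fst i) y y' s)"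
      unfolding M_def by (rule prod_sample_index[of "\<lambda>m. tilted_sum X p m y y' s", symmetric])
    have Mpos: "0 < M" unfolding M_def using tilted_sum_gt_0 by (intro prod_pos) simp
    have "?v xs = likelihood r y xs * exp (s * L xs) / M"
      unfolding M by (simp add: tilt_def prod_dividef prod.distrib likelihood_def L_def exp_sum sum_distrib_left)
    then have "pair_bound X prior p y y' r s * ?v xs
        = (pmf prior y' / pmf prior y) powr s * exp (s * L xs) * likelihood r y xs"
      using Mpos by (simp add: pair_bound_def M_def[symmetric])
    also have "\<dots> = exp (s * S xs) * likelihood r y xs"
      by (simp add: S_def powr_def exp_add distrib_left)
    also have "\<dots> \<le> exp (2 * C + 1) * likelihood r y xs"
    proof -
      have "s * S xs \<le> 1 * S xs" using S[OF xs] s by (intro mult_right_mono) auto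
      also have "\<dots> \<le> 2 * C + 1" using S[OF xs] by simp
      finally show ?thesis
        using likelihood_gt_0[of xs r y] T(1) xs by (intro mult_right_mono) auto
    qed
    finally show ?thesis .
  qed
  have n: "0 \<le> ?n" by (intro zero_le_power add_nonneg_nonneg of_nat_0_le_iff zero_le_one)
  have "pair_bound X prior p y y' r s \<le> pair_bound X prior p y y' r s * (?n * (\<Sum>xs\<in>T. ?v xs))"
    using mult_left_mono[OF T(2) pair_bound_nonneg] by simp
  also have "\<dots> = ?n * (\<Sum>xs\<in>T. pair_bound X prior p y y' r s * ?v xs)"
    by (simp add: sum_distrib_left mult_ac)
  also have "\<dots> \<le> ?n * (\<Sum>xs\<in>T. exp (2 * C + 1) * likelihood r y xs)"
    by (intro mult_left_mono sum_mono lik n)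
  also have "\<dots> \<le> ?n * (exp (2 * C + 1) * error_prob prior p prio y r)"
    unfolding sum_distrib_left[symmetric]
    by (intro mult_left_mono sum_likelihood_le_error_prob T ne n) auto
  finally show ?thesis by (simp add: mult_ac)
qed

section \<open>Signs of the tilted means and uniform contraction of the tilted sums\<close>

lemma informative_differ:
  assumes "m \<in> informative y y'"
  obtains x where "x \<in> X m" "pmf (p m y) x \<noteq> pmf (p m y') x"
proof -
  obtain x where x: "pmf (p m y) x \<noteq> pmf (p m y') x"
    using assms by (auto simp: informative_def intro: pmf_eqI)
  then have "x \<in> X m" using full_support[of m y] full_support[of m y'] by (metis pmf_eq_0_set_pmf)
  with x that show thesis by blast
qed

lemma exp_llr: "x \<in> X m \<Longrightarrow> pmf (p m y) x * exp (llr y y' m x) = pmf (p m y') x"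
  using pmf_gt_0[of x m y] pmf_gt_0[of x m y'] by (simp add: llr_def)

lemma llr_eq_0_iff: "x \<in> X m \<Longrightarrow> llr y y' m x = 0 \<longleftrightarrow> pmf (p m y) x = pmf (p m y') x"
  using pmf_gt_0[of x m y] pmf_gt_0[of x m y'] by (simp add: llr_def)

text \<open>Strict Gibbs inequality: the sum is minus the relative entropy of \<open>p m y\<close>
  with respect to \<open>p m y'\<close>, and one symbol where the laws differ makes it
  strict.\<close>

lemma mean_llr_less_0:
  assumes "m \<in> informative y y'"
  shows "(\<Sum>x\<in>X m. pmf (p m y) x * llr y y' m x) < 0"
proof -
  have le: "pmf (p m y) x * llr y y' m x \<le> pmf (p m y') x - pmf (p m y) x" if "x \<in> X m" for x
    using ln_le_minus_one[of "pmf (p m y') x / pmf (p m y) x"] pmf_gt_0[OF that, of y] pmf_gt_0[OF that, of y']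
    by (simp add: llr_def field_simps)
  obtain z where z: "z \<in> X m" "pmf (p m y) z \<noteq> pmf (p m y') z" by (rule informative_differ[OF assms])
  have "pmf (p m y) z * llr y y' m z < pmf (p m y') z - pmf (p m y) z"
    using ln_less_minus_one[of "pmf (p m y') z / pmf (p m y) z"] z pmf_gt_0[OF z(1), of y] pmf_gt_0[OF z(1), of y']
    by (simp add: llr_def field_simps)
  then have "(\<Sum>x\<in>X m. pmf (p m y) x * llr y y' m x) < (\<Sum>x\<in>X m. pmf (p m y') x - pmf (p m y) x)"
    using le z(1) alphabet by (intro sum_strict_mono_ex1) auto
  then show ?thesis by (simp add: sum_subtractf)
qed

lemma tilted_mean_0_less_0: "m \<in> informative y y' \<Longrightarrow> tilted_mean y y' 0 m < 0"
  using mean_llr_less_0[of m y y'] by (simp add: tilted_mean_def tilt_def tilted_sum_eq)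

text \<open>At \<open>s = 1\<close> the tilted law is \<open>p m y'\<close>, and exchanging the
  labels flips the sign of \<open>llr\<close>, so the Gibbs inequality applies again.\<close>

lemma tilted_mean_1_gt_0:
  assumes "m \<in> informative y y'"
  shows "0 < tilted_mean y y' 1 m"
proof -
  have "tilted_sum X p m y y' 1 = 1" by (simp add: tilted_sum_eq exp_llr)
  then have "tilted_mean y y' 1 m = (\<Sum>x\<in>X m. pmf (p m y') x * llr y y' m x)"
    by (simp add: tilted_mean_def tilt_def exp_llr)
  also have "\<dots> = - (\<Sum>x\<in>X m. pmf (p m y') x * llr y' y m x)"
    unfolding sum_negf[symmetric]
    by (intro sum.cong) (auto simp: llr_def ln_div pmf_gt_0 algebra_simps)
  finally show ?thesis using mean_llr_less_0[of m y' y] assms by (auto simp: informative_def)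
qed

lemma tilted_mean_eq_0: "m \<notin> informative y y' \<Longrightarrow> tilted_mean y y' s m = 0"
  by (simp add: tilted_mean_def informative_llr)

lemma continuous_tilted_sum: "continuous_on A (tilted_sum X p m y y')"
  unfolding tilted_sum_eq[abs_def] by (intro continuous_intros)

lemma continuous_tilted_mean: "continuous_on A (\<lambda>s. tilted_mean y y' s m)"
  unfolding tilted_mean_def tilt_def
  using tilted_sum_gt_0 by (intro continuous_intros continuous_tilted_sum) (auto simp: less_imp_neq[symmetric])

text \<open>Symbol by symbol, the geometric mixture of the two laws is at most their arithmetic
  mixture, which has total mass 1.\<close>

lemma tilted_sum_le_1:
  assumes "0 \<le> s" "s \<le> 1"
  shows "tilted_sum X p m y y' s \<le> 1"
proof -
  have "pmf (p m y) x * exp (s * llr y y' m x) \<le> (1 - s) * pmf (p m y) x + s * pmf (p m y') x"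
    if x: "x \<in> X m" for x
  proof (cases "s = 0 \<or> s = 1 \<or> llr y y' m x = 0")
    case True
    then show ?thesis using x llr_eq_0_iff[OF x, of y y'] by (auto simp: exp_llr algebra_simps)
  next
    case False
    then have "exp (s * llr y y' m x) \<le> 1 - s + s * exp (llr y y' m x)"
      using exp_scale_less[of s "llr y y' m x"] assms by simp
    then have "pmf (p m y) x * exp (s * llr y y' m x) \<le> pmf (p m y) x * (1 - s + s * exp (llr y y' m x))"
      by (intro mult_left_mono) auto
    also have "\<dots> = (1 - s) * pmf (p m y) x + s * (pmf (p m y) x * exp (llr y y' m x))"
      by (simp add: algebra_simps)
    finally show ?thesis by (simp add: exp_llr x)
  qed
  then have "tilted_sum X p m y y' s \<le> (\<Sum>x\<in>X m. (1 - s) * pmf (p m y) x + s * pmf (p m y') x)"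
    unfolding tilted_sum_eq by (rule sum_mono)
  then show ?thesis by (simp add: sum.distrib sum_distrib_left[symmetric])
qed

lemma tilted_sum_less_1:
  assumes s: "0 < s" "s < 1" and m: "m \<in> informative y y'"
  shows "tilted_sum X p m y y' s < 1"
proof -
  have *: "pmf (p m y) x * exp (s * llr y y' m x) < (1 - s) * pmf (p m y) x + s * pmf (p m y') x"
    if x: "x \<in> X m" and "llr y y' m x \<noteq> 0" for x
  proof -
    have "pmf (p m y) x * exp (s * llr y y' m x) < pmf (p m y) x * (1 - s + s * exp (llr y y' m x))"
      using that s by (intro mult_strict_left_mono exp_scale_less pmf_gt_0)
    also have "\<dots> = (1 - s) * pmf (p m y) x + s * (pmf (p m y) x * exp (llr y y' m x))"
      by (simp add: algebra_simps)
    finally show ?thesis by (simp add: exp_llr x)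
  qed
  have le: "pmf (p m y) x * exp (s * llr y y' m x) \<le> (1 - s) * pmf (p m y) x + s * pmf (p m y') x"
    if x: "x \<in> X m" for x
    using *[OF x] llr_eq_0_iff[OF x, of y y'] by (cases "llr y y' m x = 0") (auto simp: algebra_simps)
  obtain z where z: "z \<in> X m" "llr y y' m z \<noteq> 0"
    using informative_differ[OF m] llr_eq_0_iff by metis
  have "tilted_sum X p m y y' s < (\<Sum>x\<in>X m. (1 - s) * pmf (p m y) x + s * pmf (p m y') x)"
    unfolding tilted_sum_eq using *[OF z] z(1) le alphabet by (intro sum_strict_mono_ex1) auto
  then show ?thesis by (simp add: sum.distrib sum_distrib_left[symmetric])
qed

text \<open>Identifiability provides one informative model, whose factor is below 1; no other factor
  exceeds 1.\<close>

lemma prod_tilted_sum_less_1: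
  assumes s: "0 < s" "s < 1" and "y \<noteq> y'"
  shows "(\<Prod>m\<in>UNIV. tilted_sum X p m y y' s) < 1"
proof -
  obtain m where m: "m \<in> informative y y'" using identifiable[OF assms(3)] by (auto simp: informative_def)
  have "(\<Prod>m\<in>UNIV. tilted_sum X p m y y' s)
      = tilted_sum X p m y y' s * (\<Prod>l\<in>UNIV - {m}. tilted_sum X p l y y' s)"
    by (rule prod.remove) auto
  also have "\<dots> \<le> tilted_sum X p m y y' s * 1"
    using tilted_sum_le_1 s by (intro mult_left_mono prod_le_1) auto
  finally show ?thesis using tilted_sum_less_1[OF s m] by simp
qed

lemma pmf_uniformly_positive:
  obtains \<epsilon> where "0 < \<epsilon>" "\<epsilon> < 1" "\<And>m y x. x \<in> X m \<Longrightarrow> \<epsilon> \<le> pmf (p m y) x"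
proof -
  have "finite (SIGMA my:UNIV :: ('m \<times> 'y) set. X (fst my))" using alphabet by auto
  then obtain \<epsilon> where \<epsilon>: "0 < \<epsilon>" "\<epsilon> < 1"
      "\<And>a. a \<in> (SIGMA my:UNIV :: ('m \<times> 'y) set. X (fst my)) \<Longrightarrow> \<epsilon> \<le> pmf (p (fst (fst a)) (snd (fst a))) (snd a)"
    by (rule finite_uniform_positive[where f = "\<lambda>a. pmf (p (fst (fst a)) (snd (fst a))) (snd a)"])
       (auto intro: pmf_gt_0)
  from \<epsilon>(3) have "\<epsilon> \<le> pmf (p m y) x" if "x \<in> X m" for m y x
    using that by force
  with \<epsilon>(1,2) that show thesis by blast
qed

lemma prior_ratio_bounded:
  obtains l where "0 \<le> l" "\<And>y y'. \<bar>ln (pmf prior y' / pmf prior y)\<bar> \<le> l"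
proof
  \<comment> \<open>With the factor 2, each of the two log-priors contributes at most half of
    \<open>?l\<close>.\<close>
  let ?l = "\<Sum>z\<in>UNIV. 2 * \<bar>ln (pmf prior z)\<bar>"
  show "0 \<le> ?l" by (intro sum_nonneg) auto
  show "\<bar>ln (pmf prior y' / pmf prior y)\<bar> \<le> ?l" for y y'
  proof -
    have "2 * \<bar>ln (pmf prior z)\<bar> \<le> ?l" for z by (intro member_le_sum) auto
    from this[of y] this[of y'] show ?thesis by (simp add: ln_div)
  qed
qed

text \<open>The means are negative at 0 and positive at 1. By continuity and finiteness the signs
  persist, with a common margin, at \<delta> and \<open>1 - \<delta>\<close>; this allows the
  intermediate value theorem on one fixed interval.\<close>

lemma tilted_mean_signs:
  obtains \<delta> \<kappa> where "0 < \<delta>" "\<delta> < 1/2" "0 < \<kappa>"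
    and "\<And>y y' m. m \<in> informative y y' \<Longrightarrow> tilted_mean y y' \<delta> m \<le> - \<kappa>"
    and "\<And>y y' m. m \<in> informative y y' \<Longrightarrow> \<kappa> \<le> tilted_mean y y' (1 - \<delta>) m"
proof -
  define S where "S = {(y, y', m). m \<in> informative y y'}"
  have 1: "\<forall>\<^sub>F \<delta> in at_right 0. tilted_mean y y' \<delta> m < 0" if "m \<in> informative y y'" for y y' m
  proof -
    have "((\<lambda>s. tilted_mean y y' s m) \<longlongrightarrow> tilted_mean y y' 0 m) (at_right 0)"
      using continuous_tilted_mean[of UNIV y y' m]
      by (auto simp: continuous_on_def intro: tendsto_within_subset)
    then show ?thesis using tilted_mean_0_less_0[OF that] by (rule order_tendstoD)
  qed
  have 2: "\<forall>\<^sub>F \<delta> in at_right 0. 0 < tilted_mean y y' (1 - \<delta>) m" if "m \<in> informative y y'" for y y' m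
  proof -
    have "continuous_on UNIV (\<lambda>\<delta>. tilted_mean y y' (1 - \<delta>) m)"
      by (intro continuous_on_compose2[OF continuous_tilted_mean[of UNIV]] continuous_intros) auto
    then have "((\<lambda>\<delta>. tilted_mean y y' (1 - \<delta>) m) \<longlongrightarrow> tilted_mean y y' (1 - 0) m) (at_right 0)"
      unfolding continuous_on_def by (blast intro: tendsto_within_subset)
    then show ?thesis using tilted_mean_1_gt_0[OF that] by (intro order_tendstoD(1)) auto
  qed
  have "\<forall>\<^sub>F \<delta> in at_right 0. \<forall>a\<in>S. case a of (y, y', m) \<Rightarrow>
      tilted_mean y y' \<delta> m < 0 \<and> 0 < tilted_mean y y' (1 - \<delta>) m"
    by (intro eventually_ball_finite) (use 1 2 in \<open>auto simp: S_def intro: eventually_conj\<close>)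
  moreover have "\<forall>\<^sub>F \<delta> in at_right 0. 0 < \<delta> \<and> \<delta> < (1/2::real)"
    unfolding eventually_at_right_field by (intro exI[of _ "1/2"]) auto
  ultimately have "\<forall>\<^sub>F \<delta> in at_right 0. (\<forall>a\<in>S. case a of (y, y', m) \<Rightarrow>
      tilted_mean y y' \<delta> m < 0 \<and> 0 < tilted_mean y y' (1 - \<delta>) m) \<and> 0 < \<delta> \<and> \<delta> < 1/2"
    by (rule eventually_conj)
  then obtain \<delta> where \<delta>: "\<forall>a\<in>S. case a of (y, y', m) \<Rightarrow>
      tilted_mean y y' \<delta> m < 0 \<and> 0 < tilted_mean y y' (1 - \<delta>) m" "0 < \<delta>" "\<delta> < 1/2"
    using eventually_happens'[OF trivial_limit_at_right_real] by blast
  obtain \<kappa> where \<kappa>: "0 < \<kappa>" "\<And>a. a \<in> S \<Longrightarrow> \<kappa> \<le> (case a of (y, y', m) \<Rightarrow>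
      min (- tilted_mean y y' \<delta> m) (tilted_mean y y' (1 - \<delta>) m))"
    by (rule finite_uniform_positive[of S "\<lambda>a. case a of (y, y', m) \<Rightarrow>
      min (- tilted_mean y y' \<delta> m) (tilted_mean y y' (1 - \<delta>) m)"]) (use \<delta>(1) in auto)
  show thesis
  proof (rule that[OF \<delta>(2,3) \<kappa>(1)])
    fix y y' m assume "m \<in> informative y y'"
    then have "(y, y', m) \<in> S" by (simp add: S_def)
    from \<kappa>(2)[OF this] show "tilted_mean y y' \<delta> m \<le> - \<kappa>" "\<kappa> \<le> tilted_mean y y' (1 - \<delta>) m" by auto
  qed
qed

text \<open>Each product is continuous and below 1 on a compact interval, and there are finitely
  many pairs. Staying away from the endpoints is essential, since every tilted sum equals 1 at 0 and
  at 1.\<close>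

lemma prod_tilted_sum_uniform:
  assumes "0 < \<delta>"
  obtains \<theta> where "0 < \<theta>" "\<theta> < 1"
    and "\<And>y y' s. y \<noteq> y' \<Longrightarrow> s \<in> {\<delta>..1 - \<delta>} \<Longrightarrow> (\<Prod>m\<in>UNIV. tilted_sum X p m y y' s) \<le> \<theta>"
proof -
  let ?g = "\<lambda>y y' s. \<Prod>m\<in>UNIV. tilted_sum X p m y y' s"
  have "\<exists>t<1. \<forall>s\<in>{\<delta>..1 - \<delta>}. ?g y y' s \<le> t" if "y \<noteq> y'" for y y'
  proof (cases "{\<delta>..1 - \<delta>} = {}")
    case False
    have "continuous_on {\<delta>..1 - \<delta>} (?g y y')"
      by (intro continuous_on_prod continuous_tilted_sum)
    then obtain s where "s \<in> {\<delta>..1 - \<delta>}" "\<forall>u\<in>{\<delta>..1 - \<delta>}. ?g y y' u \<le> ?g y y' s"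
      using continuous_attains_sup[OF compact_Icc False] by blast
    moreover from this have "?g y y' s < 1" using assms that by (intro prod_tilted_sum_less_1) auto
    ultimately show ?thesis by blast
  qed (auto intro: exI[of _ 0])
  then obtain t where t: "\<And>y y'. y \<noteq> y' \<Longrightarrow> t y y' < 1"
      "\<And>y y' s. y \<noteq> y' \<Longrightarrow> s \<in> {\<delta>..1 - \<delta>} \<Longrightarrow> ?g y y' s \<le> t y y'"
    by metis
  obtain \<kappa> where \<kappa>: "0 < \<kappa>" "\<kappa> < 1" "\<And>a. a \<in> {(y, y'). y \<noteq> y'} \<Longrightarrow> \<kappa> \<le> 1 - t (fst a) (snd a)"
    by (rule finite_uniform_positive[of "{(y, y'). y \<noteq> y'}" "\<lambda>a. 1 - t (fst a) (snd a)"]) (use t(1) in auto)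
  show thesis
  proof (rule that[of "1 - \<kappa>"])
    fix y y' :: 'y and s assume "y \<noteq> y'" "s \<in> {\<delta>..1 - \<delta>}"
    then show "?g y y' s \<le> 1 - \<kappa>" using t(2)[of y y' s] \<kappa>(3)[of "(y, y')"] by simp
  qed (use \<kappa> in auto)
qed

lemma pair_bound_le_exp:
  assumes "0 \<le> s" "s \<le> 1" and l: "\<bar>ln (pmf prior y' / pmf prior y)\<bar> \<le> l"
  shows "pair_bound X prior p y y' r s \<le> exp l"
proof -
  have "(\<Prod>m\<in>UNIV. tilted_sum X p m y y' s ^ r m) \<le> 1"
    using tilted_sum_le_1 assms by (intro prod_le_1) (auto intro!: power_le_one)
  moreover have "(pmf prior y' / pmf prior y) powr s \<le> exp l"
  proof -
    have "s * ln (pmf prior y' / pmf prior y) \<le> s * \<bar>ln (pmf prior y' / pmf prior y)\<bar>"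
      using assms(1) by (intro mult_left_mono) auto
    also have "\<dots> \<le> 1 * \<bar>ln (pmf prior y' / pmf prior y)\<bar>"
      using assms(2) by (intro mult_right_mono) auto
    finally show ?thesis using l by (simp add: powr_def)
  qed
  ultimately show ?thesis
    unfolding pair_bound_def using mult_mono[of _ "exp l" _ 1] by (simp add: prod_nonneg)
qed

lemma pair_bound_add:
  "pair_bound X prior p y y' (\<lambda>m. r m + \<rho>) s
    = pair_bound X prior p y y' r s * (\<Prod>m\<in>UNIV. tilted_sum X p m y y' s) ^ \<rho>"
  by (simp add: pair_bound_def power_add prod.distrib prod_power_distrib)

subsection \<open>Comparison of the optimal costs\<close>

text \<open>The cases differ in the number \<open>R\<close> of informative samples. If
  \<open>R\<close> is large, some \<open>s\<close> reaches the tilted mean required by the type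
  class estimate. Otherwise the error probability is at least a constant, and so the bounded
  Chernoff term at \<open>1/2\<close> suffices.\<close>

lemma pair_bound_le_poly_error_prob:
  obtains \<delta> A where "0 < \<delta>" "\<delta> < 1/2" "1 \<le> A"
    and "\<And>prio r y y'. inj prio \<Longrightarrow> y \<noteq> y' \<Longrightarrow> error_prob prior p prio y' r < 1 \<Longrightarrow>
      \<exists>s\<in>{\<delta>..1 - \<delta>}. pair_bound X prior p y y' r s
        \<le> A * (real (sum r UNIV) + 1) ^ card (Sigma UNIV X) * error_prob prior p prio y r"
proof -
  obtain \<epsilon> where \<epsilon>: "0 < \<epsilon>" "\<epsilon> < 1" "\<And>m y x. x \<in> X m \<Longrightarrow> \<epsilon> \<le> pmf (p m y) x"
    by (rule pmf_uniformly_positive) blast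
  obtain l where l: "0 \<le> l" "\<And>y y'. \<bar>ln (pmf prior y' / pmf prior y)\<bar> \<le> l"
    by (rule prior_ratio_bounded) blast
  obtain \<delta> \<kappa> where \<delta>: "0 < \<delta>" "\<delta> < 1/2" and \<kappa>: "0 < \<kappa>"
    and lo: "\<And>y y' m. m \<in> informative y y' \<Longrightarrow> tilted_mean y y' \<delta> m \<le> - \<kappa>"
    and hi: "\<And>y y' m. m \<in> informative y y' \<Longrightarrow> \<kappa> \<le> tilted_mean y y' (1 - \<delta>) m"
    by (rule tilted_mean_signs) blast
  \<comment> \<open>\<open>- ln \<epsilon>\<close> bounds every \<open>llr\<close>, so
    \<open>C\<close> is the fluctuation constant of the type class estimate. From \<open>R0\<close>
    informative samples on, the drift \<kappa> per sample outweighs the prior term \<open>l\<close>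
    and the target \<open>C + 1\<close>; \<open>A\<close> adds up the constants of both
    cases.\<close>
  define C where "C = 2 * (- ln \<epsilon>) * real (card (Sigma UNIV X))"
  define R0 where "R0 = nat \<lceil>(C + 1 + l) / \<kappa>\<rceil>"
  define A where "A = exp (2 * C + 1) + exp l / \<epsilon> ^ R0"
  have C0: "0 \<le> C" unfolding C_def using \<epsilon> by (intro mult_nonneg_nonneg) (auto simp: ln_le_zero_iff)
  have llr: "\<bar>llr y y' m x\<bar> \<le> - ln \<epsilon>" if x: "x \<in> X m" for y y' m x
  proof -
    have "ln \<epsilon> \<le> ln (pmf (p m z) x)" "ln (pmf (p m z) x) \<le> 0" for z
      using \<epsilon>(1,3) x pmf_gt_0[OF x, of z] pmf_le_1[of "p m z" x] by auto
    moreover have "llr y y' m x = ln (pmf (p m y') x) - ln (pmf (p m y) x)"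
      using pmf_gt_0[OF x, of y] pmf_gt_0[OF x, of y'] by (simp add: llr_def ln_div)
    ultimately show ?thesis by (smt (verit))
  qed
  have A: "1 \<le> A" "exp (2 * C + 1) \<le> A" "exp l / \<epsilon> ^ R0 \<le> A"
  proof -
    have "1 \<le> exp (2 * C + 1)" using C0 by simp
    moreover have "0 < exp l / \<epsilon> ^ R0" using \<epsilon>(1) by simp
    ultimately show "1 \<le> A" "exp (2 * C + 1) \<le> A" "exp l / \<epsilon> ^ R0 \<le> A" unfolding A_def by linarith+
  qed
  show thesis
  proof (rule that[OF \<delta> A(1)])
    fix prio :: "'y \<Rightarrow> nat" and r y y'
    assume prio: "inj prio" and yy': "y \<noteq> y'" and "error_prob prior p prio y' r < 1"
    then obtain xs0 where xs0: "xs0 \<in> outputs r" "map_estimate prior p prio r xs0 = y'"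
      using error_prob_less_1_wins by blast
    let ?I = "informative y y'"
    let ?n = "(real (sum r UNIV) + 1) ^ card (Sigma UNIV X)"
    let ?e = "error_prob prior p prio y r"
    define R where "R = sum r ?I"
    have n: "1 \<le> ?n" by (intro one_le_power) (simp only: le_add_same_cancel2 of_nat_0_le_iff)
    have ge: "\<epsilon> ^ R \<le> ?e"
      unfolding R_def using \<epsilon> by (intro error_prob_ge_power[OF prio yy' xs0]) auto
    have "0 < \<epsilon> ^ R" using \<epsilon>(1) by simp
    then have e0: "0 \<le> ?e" using ge by linarith
    show "\<exists>s\<in>{\<delta>..1 - \<delta>}. pair_bound X prior p y y' r s \<le> A * ?n * ?e"
    proof (cases "R0 \<le> R")
      case True
      define F where "F s = ln (pmf prior y' / pmf prior y) + (\<Sum>m\<in>UNIV. real (r m) * tilted_mean y y' s m)" for s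
      \<comment> \<open>Uninformative models have tilted mean 0, so only the \<open>R\<close>
        informative samples move \<open>F\<close>.\<close>
      have F: "F s = ln (pmf prior y' / pmf prior y) + (\<Sum>m\<in>?I. real (r m) * tilted_mean y y' s m)" for s
        unfolding F_def by (auto simp: tilted_mean_eq_0 intro!: sum.mono_neutral_right)
      have "(C + 1 + l) / \<kappa> \<le> real R" using True unfolding R0_def by linarith
      then have R: "C + 1 + l \<le> \<kappa> * real R" using \<kappa> by (simp add: field_simps)
      have sumR: "(\<Sum>m\<in>?I. real (r m) * \<kappa>) = \<kappa> * real R"
        by (simp add: R_def sum_distrib_left mult.commute)
      have "(\<Sum>m\<in>?I. real (r m) * tilted_mean y y' \<delta> m) \<le> (\<Sum>m\<in>?I. real (r m) * - \<kappa>)"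
        using lo by (intro sum_mono mult_left_mono) auto
      then have "F \<delta> \<le> C + 1" using l(2)[of y' y] R C0 l(1) sumR by (simp add: F sum_negf)
      moreover have "(\<Sum>m\<in>?I. real (r m) * \<kappa>) \<le> (\<Sum>m\<in>?I. real (r m) * tilted_mean y y' (1 - \<delta>) m)"
        using hi by (intro sum_mono mult_left_mono) auto
      then have "C + 1 \<le> F (1 - \<delta>)" using l(2)[of y' y] R sumR by (simp add: F)
      moreover have "continuous_on {\<delta>..1 - \<delta>} F"
        unfolding F_def by (intro continuous_intros continuous_tilted_mean)
      ultimately obtain s where s: "\<delta> \<le> s" "s \<le> 1 - \<delta>" "F s = C + 1"
        using IVT'[of F \<delta> "C + 1" "1 - \<delta>"] \<delta> by auto
      have "pair_bound X prior p y y' r s \<le> exp (2 * C + 1) * ?n * ?e"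
        using s \<delta> by (intro pair_bound_le_error_prob[OF _ _ llr C_def]) (auto simp: F_def)
      also have "\<dots> \<le> A * ?n * ?e"
        using A(2) n e0 by (intro mult_right_mono) auto
      finally show ?thesis using s by auto
    next
      case False
      have "pair_bound X prior p y y' r (1/2) \<le> exp l"
        using l(2) by (intro pair_bound_le_exp) auto
      also have "\<dots> = exp l / \<epsilon> ^ R0 * \<epsilon> ^ R0" using \<epsilon>(1) by simp
      also have "\<dots> \<le> exp l / \<epsilon> ^ R0 * \<epsilon> ^ R"
        using False \<epsilon> by (intro mult_left_mono power_decreasing) auto
      also have "\<dots> \<le> A * ?e" using A ge \<epsilon>(1) by (intro mult_mono) auto
      also have "\<dots> \<le> A * ?n * ?e"
        using A(1) n e0 by (intro mult_right_mono) (auto simp: mult_le_cancel_left1)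
      finally show ?thesis using \<delta> by (intro bexI[of _ "1/2"]) auto
    qed
  qed
qed

text \<open>Any single \<open>s\<close> bounds the infimum from above. Counting all labels instead
  of the competitors costs only a constant factor.\<close>

lemma error_bound_le:
  assumes "\<And>y'. y' \<noteq> y \<Longrightarrow> \<exists>s\<in>{0..1}. pair_bound X prior p y y' r s \<le> b" and "0 \<le> b"
  shows "error_bound X prior p y r \<le> real CARD('y) * b"
proof -
  have "(INF s\<in>{0..1}. pair_bound X prior p y y' r s) \<le> b" if neq: "y' \<noteq> y" for y'
  proof -
    obtain s where s: "s \<in> {0..1}" "pair_bound X prior p y y' r s \<le> b" using assms(1)[OF neq] by blast
    have "(INF s\<in>{0..1}. pair_bound X prior p y y' r s) \<le> pair_bound X prior p y y' r s"
      using s(1) pair_bound_nonneg by (intro cINF_lower bdd_belowI2[of _ 0]) auto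
    with s(2) show ?thesis by simp
  qed
  then have "error_bound X prior p y r \<le> (\<Sum>y'\<in>UNIV - {y}. b)"
    unfolding error_bound_def by (intro sum_mono) auto
  also have "\<dots> \<le> (\<Sum>y'\<in>(UNIV :: 'y set). b)" using assms(2) by (intro sum_mono2) auto
  finally show ?thesis by simp
qed

text \<open>By the Chernoff bound, every allocation feasible for \<open>OPT_bar\<close> is feasible
  for \<open>OPT\<close>.\<close>

lemma OPT_le_OPT_bar: "OPT prior p c prio \<alpha> \<le> OPT_bar X prior p c \<alpha>"
  unfolding OPT_def OPT_bar_def min_cost_def
  by (intro INF_superset_mono) (auto intro: order_trans[OF error_prob_le_error_bound])

lemma OPT_ratio_bounds:
  assumes labels: "2 \<le> CARD('y)" and cost: "\<And>m. 0 < c m"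
  obtains a0 D where "0 < a0" "a0 < 1" "0 < D"
    and "\<And>prio \<alpha>. inj prio \<Longrightarrow> (\<And>y. 0 < \<alpha> y \<and> \<alpha> y < 1) \<Longrightarrow> Min (range \<alpha>) < a0 \<Longrightarrow>
      OPT prior p c prio \<alpha> < \<infinity> \<Longrightarrow>
      1 \<le> OPT_bar X prior p c \<alpha> / OPT prior p c prio \<alpha> \<and>
      OPT_bar X prior p c \<alpha> / OPT prior p c prio \<alpha>
        \<le> ereal (1 + D * (ln (ln (1 / Min (range \<alpha>))) / ln (1 / Min (range \<alpha>))))"
proof -
  obtain \<epsilon> where \<epsilon>: "0 < \<epsilon>" "\<epsilon> < 1" "\<And>m y x. x \<in> X m \<Longrightarrow> \<epsilon> \<le> pmf (p m y) x"
    by (rule pmf_uniformly_positive) blast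
  obtain l where l: "0 \<le> l" "\<And>y y'. \<bar>ln (pmf prior y' / pmf prior y)\<bar> \<le> l"
    by (rule prior_ratio_bounded) blast
  define d where "d = card (Sigma UNIV X)"
  obtain \<delta> A where \<delta>: "0 < \<delta>" "\<delta> < 1/2" and A: "1 \<le> A"
    and poly: "\<And>prio r y y'. inj prio \<Longrightarrow> y \<noteq> y' \<Longrightarrow> error_prob prior p prio y' r < 1 \<Longrightarrow>
      \<exists>s\<in>{\<delta>..1 - \<delta>}. pair_bound X prior p y y' r s
        \<le> A * (real (sum r UNIV) + 1) ^ d * error_prob prior p prio y r"
    unfolding d_def by (rule pair_bound_le_poly_error_prob) blast
  obtain \<theta> where \<theta>: "0 < \<theta>" "\<theta> < 1"
    and contr: "\<And>y y' s. y \<noteq> y' \<Longrightarrow> s \<in> {\<delta>..1 - \<delta>} \<Longrightarrow> (\<Prod>m\<in>UNIV. tilted_sum X p m y y' s) \<le> \<theta>"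
    by (rule prod_tilted_sum_uniform[OF \<delta>(1)]) blast
  obtain cmin where cmin: "0 < cmin" "\<And>m. cmin \<le> c m"
    by (rule finite_uniform_positive[of UNIV c]) (use cost in auto)
  \<comment> \<open>A round is one sample of every model: it costs \<open>csum\<close> and shrinks
    Chernoff terms by \<theta>, at rate \<open>t\<close>. One sample lowers an error probability at
    most by \<epsilon>, at rate \<open>h\<close>. The loss from the number of labels and the prior
    is \<open>k1\<close>. Below, \<open>k2\<close> bounds \<open>n + 1\<close> by a multiple of
    \<Lambda>, \<open>k3\<close> bounds the extra rounds by a multiple of
    \<open>ln \<Lambda>\<close>, and \<open>D\<close> compares their cost with the lower bound
    \<open>cmin * \<Lambda> / h\<close>.\<close>
  define N where "N = real CARD('y)"
  define csum where "csum = sum c UNIV"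
  define t where "t = - ln \<theta>"
  define h where "h = - ln \<epsilon>"
  define k1 where "k1 = ln N + l"
  define k2 where "k2 = csum * ((1 + k1) / t + 1) / cmin + 1"
  define k3 where "k3 = (ln (N * A) + real d * ln k2 + real d) / t + 1"
  define D where "D = k3 * csum * h / cmin"
  have N: "1 \<le> N" using labels by (simp add: N_def)
  have csum: "0 < csum" unfolding csum_def using cost by (intro sum_pos) auto
  have t: "0 < t" and h: "0 < h" using \<theta> \<epsilon> by (simp_all add: t_def h_def)
  have k1: "0 \<le> k1" using N l by (simp add: k1_def)
  have k2: "1 \<le> k2" using csum t k1 cmin by (simp add: k2_def)
  have NA: "1 \<le> N * A" using mult_mono[OF N A] N by simp
  have k3: "0 < k3" using NA k2 t by (simp add: k3_def add_nonneg_pos)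
  have D: "0 < D" using k3 csum h cmin by (simp add: D_def)

  have shift: "pair_bound X prior p y y' (\<lambda>m. r m + \<rho>) s \<le> pair_bound X prior p y y' r s * \<theta> ^ \<rho>"
    if "y \<noteq> y'" "s \<in> {\<delta>..1 - \<delta>}" for y y' r \<rho> s
    unfolding pair_bound_add using contr[OF that]
    by (intro mult_left_mono power_mono pair_bound_nonneg prod_nonneg) auto
  have cost_add: "total_cost c (\<lambda>m. r m + \<rho>) = total_cost c r + csum * real \<rho>" for r \<rho>
    by (simp add: total_cost_def csum_def sum.distrib distrib_left sum_distrib_right)
  have theta_le: "\<theta> ^ \<rho> \<le> exp (- v)" if "v / t \<le> real \<rho>" for \<rho> v
  proof -
    have "v \<le> t * real \<rho>" using that t by (simp add: field_simps)
    moreover have "\<theta> ^ \<rho> = exp (- (t * real \<rho>))"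
      using \<theta>(1) exp_of_nat_mult[of \<rho> "ln \<theta>"] by (simp add: t_def mult.commute)
    ultimately show ?thesis by simp
  qed

  show thesis
  \<comment> \<open>This threshold forces \<open>\<Lambda> > exp 1\<close>, hence
    \<open>ln \<Lambda> \<ge> 1\<close>, so additive constants can be absorbed into multiples of
    \<Lambda> and \<open>ln \<Lambda>\<close>.\<close>
  proof (rule that[of "exp (- exp 1)" D])
    fix prio :: "'y \<Rightarrow> nat" and \<alpha> :: "'y \<Rightarrow> real"
    assume prio: "inj prio" and \<alpha>: "\<And>y. 0 < \<alpha> y \<and> \<alpha> y < 1"
      and small: "Min (range \<alpha>) < exp (- exp 1)" and fin: "OPT prior p c prio \<alpha> < \<infinity>"
    define a where "a = Min (range \<alpha>)"
    have a_le: "a \<le> \<alpha> y" for y unfolding a_def by (intro Min_le) auto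
    obtain y0 where y0: "\<alpha> y0 = a" using Min_in[of "range \<alpha>"] unfolding a_def by fastforce
    have a: "0 < a" "a < exp (- exp 1)" using \<alpha>[of y0] y0 small by (auto simp: a_def)
    define \<Lambda> where "\<Lambda> = ln (1 / a)"
    have \<Lambda>a: "\<Lambda> = - ln a" using a(1) by (simp add: \<Lambda>_def ln_div)
    have "ln a < - exp 1" using a by (metis ln_exp ln_less_cancel_iff exp_gt_zero)
    then have \<Lambda>: "exp 1 < \<Lambda>" by (simp add: \<Lambda>a)
    have \<Lambda>1: "1 < \<Lambda>" using \<Lambda> exp_ge_add_one_self[of 1] by linarith
    have ln\<Lambda>: "1 \<le> ln \<Lambda>" using \<Lambda> \<Lambda>1 by (metis exp_gt_zero less_imp_le ln_exp ln_le_cancel_iff less_trans zero_less_one)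
    define F where "F = {r. \<forall>y. error_prob prior p prio y r \<le> \<alpha> y}"
    have OPT_F: "OPT prior p c prio \<alpha> = min_cost c F" by (simp add: OPT_def F_def)
    have "F \<noteq> {}" using fin unfolding OPT_F min_cost_def by (auto simp: top_ereal_def)
    then obtain r where r: "r \<in> F" and OPT: "OPT prior p c prio \<alpha> = ereal (total_cost c r)"
      using min_cost_attained[of c F, OF cost] unfolding OPT_F by auto
    have feas: "error_prob prior p prio y r \<le> \<alpha> y" for y using r by (simp add: F_def)
    have lt1: "error_prob prior p prio y r < 1" for y using feas[of y] \<alpha>[of y] by simp
    define n where "n = real (sum r UNIV)"
    have n0: "0 \<le> n" unfolding n_def by (rule of_nat_0_le_iff)

    have n_cost: "cmin * n \<le> total_cost c r"
      unfolding n_def total_cost_def of_nat_sum sum_distrib_left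
      using cmin(2) by (intro sum_mono mult_right_mono) auto
    \<comment> \<open>The strictest label \<open>y0\<close> has a rival that wins for some output,
      so its error probability is at least \<epsilon> to the number of samples.\<close>
    have "\<Lambda> \<le> h * n"
    proof -
      have "(UNIV :: 'y set) \<noteq> {y0}"
      proof
        assume "(UNIV :: 'y set) = {y0}"
        then have "CARD('y) = card {y0}" by (rule arg_cong)
        then show False using labels by simp
      qed
      then obtain y' where y': "y0 \<noteq> y'" by (metis UNIV_eq_I singleton_iff)
      obtain xs where xs: "xs \<in> outputs r" "map_estimate prior p prio r xs = y'"
        using error_prob_less_1_wins[OF lt1] by blast
      have "\<epsilon> ^ sum r UNIV \<le> \<epsilon> ^ sum r (informative y0 y')"
        using \<epsilon> by (intro power_decreasing sum_mono2) auto
      also have "\<dots> \<le> error_prob prior p prio y0 r"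
        using \<epsilon> by (intro error_prob_ge_power[OF prio y' xs]) auto
      also have "\<dots> \<le> a" using feas[of y0] y0 by simp
      finally have "ln (\<epsilon> ^ sum r UNIV) \<le> ln a" using \<epsilon>(1) a(1) by (subst ln_le_cancel_iff) auto
      then show ?thesis using \<epsilon>(1) by (simp only: ln_realpow h_def n_def \<Lambda>a) (simp add: mult.commute)
    qed
    then have "cmin * \<Lambda> / h \<le> cmin * n"
      using cmin(1) h by (simp add: divide_le_eq mult_ac)
    then have cost_ge: "cmin * \<Lambda> / h \<le> total_cost c r" using n_cost by linarith
    have "0 < cmin * \<Lambda> / h" using cmin(1) h \<Lambda>1 by simp
    then have cost_pos: "0 < total_cost c r" using cost_ge by linarith

    \<comment> \<open>Conversely, \<rho> rounds from scratch are already feasible by the Chernoff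
      bound at \<open>1/2\<close>, and their cost bounds the optimum. Writing
      \<open>0 + \<rho>\<close> lets \<open>shift\<close> apply to the empty allocation.\<close>
    have n_le: "n + 1 \<le> k2 * \<Lambda>"
    proof -
      define \<rho> where "\<rho> = nat \<lceil>(\<Lambda> + k1) / t\<rceil>"
      have "0 \<le> (\<Lambda> + k1) / t" using \<Lambda>1 k1 t by simp
      then have \<rho>: "(\<Lambda> + k1) / t \<le> real \<rho>" "real \<rho> \<le> (\<Lambda> + k1) / t + 1"
        unfolding \<rho>_def by linarith+
      have "(\<lambda>m. 0 + \<rho>) \<in> F"
        unfolding F_def mem_Collect_eq
      proof
        fix y
        have "error_prob prior p prio y (\<lambda>m. 0 + \<rho>) \<le> error_bound X prior p y (\<lambda>m. 0 + \<rho>)"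
          by (rule error_prob_le_error_bound)
        also have "\<dots> \<le> N * (exp l * \<theta> ^ \<rho>)"
          unfolding N_def
        proof (rule error_bound_le)
          fix y' assume "y' \<noteq> y"
          then have "pair_bound X prior p y y' (\<lambda>m. 0 + \<rho>) (1/2) \<le> pair_bound X prior p y y' (\<lambda>m. 0) (1/2) * \<theta> ^ \<rho>"
            using \<delta> by (intro shift) auto
          also have "\<dots> \<le> exp l * \<theta> ^ \<rho>"
            using \<theta> l(2) by (intro mult_right_mono pair_bound_le_exp) auto
          finally show "\<exists>s\<in>{0..1}. pair_bound X prior p y y' (\<lambda>m. 0 + \<rho>) s \<le> exp l * \<theta> ^ \<rho>"
            by (intro bexI[of _ "1/2"]) auto
        qed (use \<theta> in auto)
        also have "\<dots> \<le> N * (exp l * exp (- (\<Lambda> + k1)))"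
          using N by (intro mult_left_mono theta_le \<rho>) auto
        also have "\<dots> = a"
          using N a(1) by (simp add: k1_def \<Lambda>a exp_add exp_minus exp_diff)
        also have "\<dots> \<le> \<alpha> y" by (rule a_le)
        finally show "error_prob prior p prio y (\<lambda>m. 0 + \<rho>) \<le> \<alpha> y" .
      qed
      then have "ereal (total_cost c r) \<le> ereal (total_cost c (\<lambda>m. 0 + \<rho>))"
        unfolding OPT[symmetric] OPT_F min_cost_def by (rule INF_lower)
      then have "cmin * n \<le> csum * real \<rho>"
        using n_cost cost_add[of "\<lambda>_. 0" \<rho>] by (simp add: total_cost_def)
      also have "\<dots> \<le> csum * ((\<Lambda> + k1) / t + 1)" using \<rho>(2) csum by (intro mult_left_mono) auto
      also have "\<dots> \<le> csum * (((1 + k1) / t + 1) * \<Lambda>)"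
      proof -
        have "(\<Lambda> + k1) / t \<le> (1 + k1) * \<Lambda> / t"
          using \<Lambda>1 k1 t mult_left_mono[of 1 \<Lambda> k1] by (intro divide_right_mono) (auto simp: algebra_simps)
        then have "(\<Lambda> + k1) / t + 1 \<le> ((1 + k1) / t + 1) * \<Lambda>" using \<Lambda>1 by (simp add: algebra_simps)
        then show ?thesis using csum by (intro mult_left_mono) auto
      qed
      finally have "n \<le> csum * ((1 + k1) / t + 1) / cmin * \<Lambda>"
        using cmin(1) by (simp add: field_simps)
      then show ?thesis using \<Lambda>1 by (simp add: k2_def algebra_simps)
    qed

    \<comment> \<open>\<open>v\<close> is the logarithm of the whole loss, the number of labels
      times the polynomial factor; \<rho> extra rounds contribute at most \<open>exp (- v)\<close>
      and cancel it.\<close>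
    define v where "v = ln (N * A * (n + 1) ^ d)"
    define \<rho> where "\<rho> = nat \<lceil>v / t\<rceil>"
    have arg: "1 \<le> N * A * (n + 1) ^ d" using mult_mono[OF NA one_le_power[of "n + 1" d]] NA n0 by simp
    have exp_v: "N * A * (n + 1) ^ d = exp v" using arg by (simp add: v_def)
    have v0: "0 \<le> v" using arg by (simp add: v_def)
    then have "0 \<le> v / t" using t by simp
    then have \<rho>: "v / t \<le> real \<rho>" "real \<rho> \<le> v / t + 1" unfolding \<rho>_def by linarith+
    \<comment> \<open>As \<open>n + 1 \<le> k2 * \<Lambda>\<close>, a loss polynomial in
      \<open>n\<close> costs only a multiple of \<open>ln \<Lambda>\<close> in the exponent.\<close>
    have "v \<le> (ln (N * A) + real d * ln k2 + real d) * ln \<Lambda>"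
    proof -
      have "v = ln (N * A) + real d * ln (n + 1)"
        unfolding v_def using NA n0 by (subst ln_mult) (auto simp: ln_realpow)
      also have "\<dots> \<le> ln (N * A) + real d * ln (k2 * \<Lambda>)"
        using n_le n0 k2 \<Lambda>1 by (intro add_left_mono mult_left_mono) auto
      also have "\<dots> = ln (N * A) + real d * ln k2 + real d * ln \<Lambda>"
        using k2 \<Lambda>1 by (simp add: ln_mult distrib_left)
      also have "\<dots> \<le> (ln (N * A) + real d * ln k2) * ln \<Lambda> + real d * ln \<Lambda>"
      proof -
        have "0 \<le> ln (N * A) + real d * ln k2" using NA k2 by simp
        from mult_left_mono[OF ln\<Lambda> this] show ?thesis by simp
      qed
      finally show ?thesis by (simp add: algebra_simps)
    qed
    then have "v / t \<le> (ln (N * A) + real d * ln k2 + real d) * ln \<Lambda> / t"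
      using t by (intro divide_right_mono) auto
    then have \<rho>_le: "real \<rho> \<le> k3 * ln \<Lambda>"
      using \<rho>(2) ln\<Lambda> by (simp add: k3_def distrib_right)

    have bar_feas: "error_bound X prior p y (\<lambda>m. r m + \<rho>) \<le> \<alpha> y" for y
    proof -
      let ?b = "A * (n + 1) ^ d * \<alpha> y * \<theta> ^ \<rho>"
      have An: "0 \<le> A * (n + 1) ^ d" using A n0 by simp
      have "error_bound X prior p y (\<lambda>m. r m + \<rho>) \<le> N * ?b"
        unfolding N_def
      proof (rule error_bound_le)
        fix y' assume y': "y' \<noteq> y"
        obtain s where s: "s \<in> {\<delta>..1 - \<delta>}"
            "pair_bound X prior p y y' r s \<le> A * (n + 1) ^ d * error_prob prior p prio y r"
          using poly[OF prio y'[symmetric] lt1] unfolding n_def by blast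
        have "pair_bound X prior p y y' (\<lambda>m. r m + \<rho>) s \<le> pair_bound X prior p y y' r s * \<theta> ^ \<rho>"
          using y' s by (intro shift) auto
        also have "\<dots> \<le> ?b"
          using order_trans[OF s(2) mult_left_mono[OF feas An]] \<theta> by (intro mult_right_mono) auto
        finally show "\<exists>s\<in>{0..1}. pair_bound X prior p y y' (\<lambda>m. r m + \<rho>) s \<le> ?b"
          using s(1) \<delta> by (intro bexI[of _ s]) auto
      qed (use An \<alpha>[of y] \<theta> in auto)
      also have "\<dots> = N * A * (n + 1) ^ d * \<theta> ^ \<rho> * \<alpha> y" by (simp add: mult_ac)
      also have "\<dots> \<le> N * A * (n + 1) ^ d * exp (- v) * \<alpha> y"
        using arg \<alpha>[of y] by (intro mult_right_mono mult_left_mono theta_le \<rho>) auto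
      also have "\<dots> = \<alpha> y" by (simp add: exp_v exp_minus)
      finally show ?thesis .
    qed
    have "OPT_bar X prior p c \<alpha> \<le> ereal (total_cost c (\<lambda>m. r m + \<rho>))"
      unfolding OPT_bar_def min_cost_def using bar_feas by (intro INF_lower) auto
    then have bar_le: "OPT_bar X prior p c \<alpha> \<le> ereal (total_cost c r + csum * real \<rho>)"
      by (simp only: cost_add)
    have bar_ge: "ereal (total_cost c r) \<le> OPT_bar X prior p c \<alpha>"
      using OPT_le_OPT_bar[of c prio \<alpha>] by (simp add: OPT)
    obtain b where b: "OPT_bar X prior p c \<alpha> = ereal b"
      using bar_le bar_ge by (cases "OPT_bar X prior p c \<alpha>") auto
    have ratio: "OPT_bar X prior p c \<alpha> / OPT prior p c prio \<alpha> = ereal (b / total_cost c r)"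
      using cost_pos by (simp add: OPT b)
    \<comment> \<open>Extra cost of order \<open>ln \<Lambda>\<close> against an optimum of order at
      least \<Lambda>.\<close>
    have "csum * real \<rho> / total_cost c r \<le> csum * (k3 * ln \<Lambda>) / (cmin * \<Lambda> / h)"
      using \<rho>_le csum cost_ge cmin(1) h \<Lambda>1 k3 ln\<Lambda> by (intro frac_le mult_left_mono) auto
    also have "\<dots> = D * (ln \<Lambda> / \<Lambda>)" using cmin(1) h \<Lambda>1 by (simp add: D_def field_simps)
    finally have "b / total_cost c r \<le> 1 + D * (ln \<Lambda> / \<Lambda>)"
      using bar_le cost_pos by (simp add: b field_simps)
    moreover have "1 \<le> b / total_cost c r" using bar_ge cost_pos by (simp add: b)
    ultimately show "1 \<le> OPT_bar X prior p c \<alpha> / OPT prior p c prio \<alpha> \<and>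
      OPT_bar X prior p c \<alpha> / OPT prior p c prio \<alpha>
        \<le> ereal (1 + D * (ln (ln (1 / Min (range \<alpha>))) / ln (1 / Min (range \<alpha>))))"
      by (simp add: ratio \<Lambda>_def a_def one_ereal_def)
  qed (use D in auto)
qed

end

section \<open>Uniform bounds on the ratio and its limit\<close>

theorem theorem4p8:
  fixes prior :: "'y::finite pmf"
    and X :: "'m::finite \<Rightarrow> 'x set"
    and p :: "'m \<Rightarrow> 'y \<Rightarrow> 'x pmf"
    and c :: "'m \<Rightarrow> real"
  assumes labels: "CARD('y) \<ge> 2"
    and prior_pos: "set_pmf prior = UNIV"
    and alphabet: "\<And>m. finite (X m)"
    and full_support: "\<And>m y. set_pmf (p m y) = X m"
    and cost_pos: "\<And>m. 0 < c m"
    and identifiable: "\<And>y y'. y \<noteq> y' \<Longrightarrow> \<exists>m. p m y \<noteq> p m y'"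
    and bounded_llr: "\<exists>B. \<forall>m y y'. y \<noteq> y' \<longrightarrow>
          (\<forall>x\<in>X m. \<bar>ln (pmf (p m y') x / pmf (p m y) x)\<bar> \<le> B)"
  shows "(\<exists>a0 D. 0 < a0 \<and> a0 < 1 \<and> 0 < D \<and>
           (\<forall>prio \<alpha>. inj prio \<longrightarrow> (\<forall>y. 0 < \<alpha> y \<and> \<alpha> y < 1) \<longrightarrow> Min (range \<alpha>) < a0 \<longrightarrow>
              OPT prior p c prio \<alpha> < \<infinity> \<longrightarrow>
              1 \<le> OPT_bar X prior p c \<alpha> / OPT prior p c prio \<alpha> \<and>
              OPT_bar X prior p c \<alpha> / OPT prior p c prio \<alpha>
                \<le> ereal (1 + D * (ln (ln (1 / Min (range \<alpha>))) / ln (1 / Min (range \<alpha>))))))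
         \<and> (\<forall>prio. inj prio \<longrightarrow>
              ((\<lambda>\<alpha>. OPT_bar X prior p c \<alpha> / OPT prior p c prio \<alpha>) \<longlongrightarrow> 1)
                (inf (filtercomap (\<lambda>\<alpha>. Min (range \<alpha>)) (at_right 0))
                  (principal {\<alpha>. (\<forall>y. 0 < \<alpha> y \<and> \<alpha> y < 1) \<and> OPT prior p c prio \<alpha> < \<infinity>})))"
proof -
  interpret classification prior X p
    using prior_pos alphabet full_support identifiable by unfold_locales
  obtain a0 D where a0: "0 < a0" "a0 < 1" and D: "0 < D"
    and bounds: "\<And>prio \<alpha>. inj prio \<Longrightarrow> (\<And>y. 0 < \<alpha> y \<and> \<alpha> y < 1) \<Longrightarrow> Min (range \<alpha>) < a0 \<Longrightarrow>
      OPT prior p c prio \<alpha> < \<infinity> \<Longrightarrow>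
      1 \<le> OPT_bar X prior p c \<alpha> / OPT prior p c prio \<alpha> \<and>
      OPT_bar X prior p c \<alpha> / OPT prior p c prio \<alpha>
        \<le> ereal (1 + D * (ln (ln (1 / Min (range \<alpha>))) / ln (1 / Min (range \<alpha>))))"
    by (rule OPT_ratio_bounds[of c, OF labels cost_pos]) blast
  \<comment> \<open>The filter lets the least tolerance tend to 0 from above among admissible
    \<alpha> with finite optimum. The upper bound depends on \<alpha> only through this minimum, so
    a one-variable limit and a sandwich suffice.\<close>
  have lim: "((\<lambda>\<alpha>. OPT_bar X prior p c \<alpha> / OPT prior p c prio \<alpha>) \<longlongrightarrow> 1)
      (inf (filtercomap (\<lambda>\<alpha>. Min (range \<alpha>)) (at_right 0))
        (principal {\<alpha>. (\<forall>y. 0 < \<alpha> y \<and> \<alpha> y < 1) \<and> OPT prior p c prio \<alpha> < \<infinity>}))"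
    (is "(?ratio \<longlongrightarrow> 1) (inf ?G (principal ?S))") if prio: "inj prio" for prio
  proof -
    let ?u = "\<lambda>x. ereal (1 + D * (ln (ln (1 / x)) / ln (1 / x)))"
    have "((\<lambda>x::real. 1 + D * (ln (ln (1 / x)) / ln (1 / x))) \<longlongrightarrow> 1) (at_right 0)"
      by real_asymp
    then have "(?u \<longlongrightarrow> 1) (at_right 0)" by (simp add: one_ereal_def)
    then have upper: "((\<lambda>\<alpha>. ?u (Min (range \<alpha>))) \<longlongrightarrow> 1) (inf ?G (principal ?S))"
      by (rule filterlim_compose) (rule filterlim_mono[OF filterlim_filtercomap order_refl inf_le1])
    have "\<forall>\<^sub>F x in at_right 0. x < a0"
      using a0(1) by (auto simp: eventually_at_right_field)
    then have "\<forall>\<^sub>F \<alpha> in ?G. Min (range \<alpha>) < a0"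
      by (rule eventually_filtercomapI)
    then have ev: "\<forall>\<^sub>F \<alpha> in inf ?G (principal ?S). 1 \<le> ?ratio \<alpha> \<and> ?ratio \<alpha> \<le> ?u (Min (range \<alpha>))"
      unfolding eventually_inf_principal
      by (rule eventually_mono) (use bounds[OF prio] in blast)
    show ?thesis
      by (rule tendsto_sandwich[OF _ _ tendsto_const upper]) (use ev in \<open>auto elim: eventually_mono\<close>)
  qed
  show ?thesis
  proof (rule conjI, rule exI[of _ a0], rule exI[of _ D], intro conjI allI impI a0 D)
    fix prio :: "'y \<Rightarrow> nat" and \<alpha> :: "'y \<Rightarrow> real"
    assume "inj prio" "\<forall>y. 0 < \<alpha> y \<and> \<alpha> y < 1" "Min (range \<alpha>) < a0" "OPT prior p c prio \<alpha> < \<infinity>"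
    then have *: "1 \<le> OPT_bar X prior p c \<alpha> / OPT prior p c prio \<alpha> \<and>
        OPT_bar X prior p c \<alpha> / OPT prior p c prio \<alpha>
          \<le> ereal (1 + D * (ln (ln (1 / Min (range \<alpha>))) / ln (1 / Min (range \<alpha>))))"
      using bounds by blast
    show "1 \<le> OPT_bar X prior p c \<alpha> / OPT prior p c prio \<alpha>" using * ..
    show "OPT_bar X prior p c \<alpha> / OPT prior p c prio \<alpha>
        \<le> ereal (1 + D * (ln (ln (1 / Min (range \<alpha>))) / ln (1 / Min (range \<alpha>))))" using * ..
  qed (use lim in blast)
qed

end
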